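(* Let $\mathcal{E}' \subset (0,1)^2$ be the dense $G_\delta$ set, and $\mathcal{E}$ the set of rational dimensions, described in the context. Let $\mathcal{F} \subset (0,1)^2 \cup \{(0,0)\}$ be a finite or countable set with $\mathcal{F} \cap (\mathcal{E} \cup \mathcal{E}') \neq \emptyset$. Let $\nu$ be a Borel probability measure on $\mathcal{F}^{\mathbb{Z}^2}$ which is invariant and ergodic for the $\mathbb{Z}^2$-shift action. Then either for $\nu$-almost every $W \in \mathcal{F}^{\mathbb{Z}^2}$ the wind-tree model $W$ is recurrent, or for $\nu$-almost every $W \in \mathcal{F}^{\mathbb{Z}^2}$ the wind-tree model $W$ is not recurrent.
   Context: Wind-tree models. An element $W = (W_{(i,j)})_{(i,j)\in\mathbb{Z}^2} \in \mathcal{F}^{\mathbb{Z}^2}$ is identified with a billiard table: for each $(i,j)\in\mathbb{Z}^2$ with $W_{(i,j)} = (a,b) \neq (0,0)$, a rectangular obstacle with sides parallel to the coordinate axes, width $a$ and height $b$, is placed with its center at $(i,j)$; if $W_{(i,j)} = (0,0)$ there is no obstacle at $(i,j)$. The billiard table is the plane $\mathbb{R}^2$ with the obstacles removed. For $e \in (0,1)^2$, $W_e$ denotes the table with the identical obstacle $e$ at every lattice site. $\mathcal{F}^{\mathbb{Z}^2}$ carries the product topology with $\mathcal{F}$ discrete, so that cylinder sets (given by specifying the obstacles at finitely many lattice sites) are open. The group $\mathbb{Z}^2$ acts on it by shifts (translation of the index). Billiard flow. A point particle moves at constant unit speed in straight lines in the table and bounces off the obstacles according to the usual law of geometric optics (angle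 of incidence equals angle of reflection). This defines, up to a set of measure $0$ of singular points (orbits hitting corners), a flow on the phase space (position in the table, unit velocity vector), which preserves the natural phase volume (Lebesgue measure on the table times Lebesgue measure on $\mathbb{S}^1$). Recurrence. Let $\Phi$ be a flow on a measured topological space $(\Omega,\mu)$. A point $x\in\Omega$ is recurrent if for every neighborhood $U$ of $x$ and every $T_0>0$ there is $T>T_0$ with $\Phi_T(x)\in U$. The flow is recurrent if $\mu$-almost every point is recurrent. A wind-tree model $W$ is called recurrent if its billiard flow is recurrent with respect to the natural phase volume. The sets $\mathcal{E}$, $\mathcal{E}'$. $\mathcal{E}$ is the set of $(a,b) = (p/q, r/s) \in \mathbb{Q}\times\mathbb{Q}$ with $\gcd(p,q)=\gcd(r,s)=1$, $0<p<q$, $0<r<s$, $p,r$ odd and $q,s$ even. $\mathcal{E}'$ is a fixed dense $G_\delta$ subset of $(0,1)^2$ such that for every $e\in\mathcal{E}'$ the billiard flow on $W_e$ is recurrent (the existence of such a set is due to Hubert, Lelièvre and Troubetzkoy). *)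

theory Defs
  imports "HOL-Probability.Probability"
begin

section \<open>Wind-tree tables\<close>

type_synonym vec = "real \<times> real"
type_synonym configuration = "int \<times> int \<Rightarrow> vec"

definition unit_square :: "vec set" where
  "unit_square = {0<..<1} \<times> {0<..<1}"

definition obstacle_sites :: "configuration \<Rightarrow> (int \<times> int) set" where
  "obstacle_sites W = {ij. W ij \<noteq> (0, 0)}"

text \<open>Removing the open rectangles leaves the sides of the obstacles in the table, so that a
  particle may be located on a side at the time of a collision.\<close>

definition table :: "configuration \<Rightarrow> vec set" where
  "table W = - (\<Union>(i, j) \<in> obstacle_sites W.
      {(x, y). \<bar>x - i\<bar> < fst (W (i, j)) / 2 \<and> \<bar>y - j\<bar> < snd (W (i, j)) / 2})"

definition vertical_sides :: "configuration \<Rightarrow> vec set" where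
  "vertical_sides W = (\<Union>(i, j) \<in> obstacle_sites W.
      {(x, y). \<bar>x - i\<bar> = fst (W (i, j)) / 2 \<and> \<bar>y - j\<bar> < snd (W (i, j)) / 2})"

definition horizontal_sides :: "configuration \<Rightarrow> vec set" where
  "horizontal_sides W = (\<Union>(i, j) \<in> obstacle_sites W.
      {(x, y). \<bar>x - i\<bar> < fst (W (i, j)) / 2 \<and> \<bar>y - j\<bar> = snd (W (i, j)) / 2})"

definition corners :: "configuration \<Rightarrow> vec set" where
  "corners W = (\<Union>(i, j) \<in> obstacle_sites W.
      {(x, y). \<bar>x - i\<bar> = fst (W (i, j)) / 2 \<and> \<bar>y - j\<bar> = snd (W (i, j)) / 2})"


section \<open>The billiard flow\<close>

text \<open>Velocity after passing through the position \<open>p\<close> with incoming velocity \<open>u\<close>. On a side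
  the normal component changes sign, and elsewhere the velocity is unchanged.\<close>

definition outgoing_velocity :: "configuration \<Rightarrow> vec \<Rightarrow> vec \<Rightarrow> vec" where
  "outgoing_velocity W p u =
     (if p \<in> vertical_sides W then (- fst u, snd u)
      else if p \<in> horizontal_sides W then (fst u, - snd u)
      else u)"

text \<open>A complete nonsingular trajectory \<open>t \<mapsto> (q t, v t)\<close>. Near every time the motion is
  straight with unit velocity \<open>u\<close> before and \<open>v t\<close> after, so the velocity at the time of a
  collision is the outgoing one. Trajectories never meet a corner.\<close>

definition billiard_trajectory :: "configuration \<Rightarrow> (real \<Rightarrow> vec) \<Rightarrow> (real \<Rightarrow> vec) \<Rightarrow> bool" where
  "billiard_trajectory W q v \<longleftrightarrow>
     (\<forall>t. q t \<in> table W \<and> q t \<notin> corners W \<and> norm (v t) = 1 \<and>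
       (\<exists>u. v t = outgoing_velocity W (q t) u \<and>
         (\<exists>\<epsilon>>0.
           (\<forall>s\<in>{0..<\<epsilon>}. q (t + s) = q t + s *\<^sub>R v t \<and> v (t + s) = v t) \<and>
           (\<forall>s\<in>{0<..<\<epsilon>}. q (t - s) = q t - s *\<^sub>R u \<and> v (t - s) = u))))"

definition regular_points :: "configuration \<Rightarrow> (vec \<times> vec) set" where
  "regular_points W = {x. \<exists>q v. billiard_trajectory W q v \<and> (q 0, v 0) = x}"

text \<open>Only meaningful on \<open>regular_points W\<close>, where the trajectory through a given point is unique:
  \<open>outgoing_velocity W p\<close> is an involution, so the trajectory is locally determined in both time
  directions.\<close>

definition billiard_flow :: "configuration \<Rightarrow> real \<Rightarrow> vec \<times> vec \<Rightarrow> vec \<times> vec" where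
  "billiard_flow W t x =
     (THE y. \<exists>q v. billiard_trajectory W q v \<and> (q 0, v 0) = x \<and> (q t, v t) = y)"

definition circle_measure :: "vec measure" where
  "circle_measure =
     distr (restrict_space lborel {0..<2 * pi}) borel (\<lambda>\<theta>. (cos \<theta>, sin \<theta>))"

definition phase_volume :: "configuration \<Rightarrow> (vec \<times> vec) measure" where
  "phase_volume W = restrict_space lborel (table W) \<Otimes>\<^sub>M circle_measure"


section \<open>Recurrence\<close>

definition recurrent_point :: "'a topology \<Rightarrow> (real \<Rightarrow> 'a \<Rightarrow> 'a) \<Rightarrow> 'a \<Rightarrow> bool" where
  "recurrent_point X \<Phi> x \<longleftrightarrow> x \<in> topspace X \<and>
     (\<forall>U T0. openin X U \<and> x \<in> U \<and> T0 > 0 \<longrightarrow> (\<exists>T>T0. \<Phi> T x \<in> U))"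

definition recurrent_flow :: "'a topology \<Rightarrow> 'a measure \<Rightarrow> (real \<Rightarrow> 'a \<Rightarrow> 'a) \<Rightarrow> bool" where
  "recurrent_flow X \<mu> \<Phi> \<longleftrightarrow> (AE x in \<mu>. recurrent_point X \<Phi> x)"

text \<open>The flow lives on the regular points, while the measure is the phase volume of the whole phase
  space; recurrence thus includes that the singular points form a null set.\<close>

definition recurrent_wind_tree :: "configuration \<Rightarrow> bool" where
  "recurrent_wind_tree W \<longleftrightarrow>
     recurrent_flow (top_of_set (regular_points W)) (phase_volume W) (billiard_flow W)"


section \<open>Sets of obstacle dimensions\<close>

definition rational_dimensions :: "vec set" where
  "rational_dimensions = {(real p / real q, real r / real s) | p q r s :: nat.
     coprime p q \<and> coprime r s \<and> 0 < p \<and> p < q \<and> 0 < r \<and> r < s \<and>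
     odd p \<and> odd r \<and> even q \<and> even s}"

definition recurrent_dense_gdelta :: "vec set \<Rightarrow> bool" where
  "recurrent_dense_gdelta E' \<longleftrightarrow>
     E' \<subseteq> unit_square \<and> unit_square \<subseteq> closure E' \<and>
     gdelta_in (top_of_set unit_square) E' \<and>
     (\<forall>e\<in>E'. recurrent_wind_tree (\<lambda>_. e))"


section \<open>Shift-invariant ergodic measures\<close>

definition configuration_topology :: "vec set \<Rightarrow> configuration topology" where
  "configuration_topology F = product_topology (\<lambda>_. discrete_topology F) UNIV"

definition borel_probability_on :: "'a topology \<Rightarrow> 'a measure \<Rightarrow> bool" where
  "borel_probability_on X \<nu> \<longleftrightarrow> prob_space \<nu> \<and> space \<nu> = topspace X \<and>
     sets \<nu> = sigma_sets (topspace X) {U. openin X U}"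

definition shift :: "int \<times> int \<Rightarrow> configuration \<Rightarrow> configuration" where
  "shift k W = (\<lambda>ij. W (ij + k))"

definition shift_invariant :: "configuration measure \<Rightarrow> bool" where
  "shift_invariant \<nu> \<longleftrightarrow> (\<forall>k. distr \<nu> \<nu> (shift k) = \<nu>)"

definition shift_ergodic :: "configuration measure \<Rightarrow> bool" where
  "shift_ergodic \<nu> \<longleftrightarrow>
     (\<forall>A\<in>sets \<nu>. (\<forall>k. shift k -` A \<inter> space \<nu> = A) \<longrightarrow> measure \<nu> A = 0 \<or> measure \<nu> A = 1)"

end

theory Submission
  imports Defs
begin

text \<open>By ergodicity it suffices that the set of recurrent configurations is shift invariant and
  measurable. Invariance holds because shifting a configuration translates its trajectories.
  For measurability, recurrence is written as a countable combination of conditions each involving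
  trajectories of bounded duration that start in a bounded region, hence only finitely many
  obstacles; every such condition defines an open set of configurations. The only limit to be
  interchanged with the phase volume is over the sets of points that do not return before time
  \<open>m\<close>; they decrease with \<open>m\<close> and are measurable up to null sets, since away from the sides
  the flow is continuous: a regular trajectory avoids the corners and meets sides transversally.\<close>

section \<open>Trajectories on a set of times\<close>

text \<open>A trajectory is given by a condition on its germ at each time, not by a list of
  collisions, and no bound on the number of collisions in a time interval is available in advance.
  Statements are therefore propagated by induction along the real time axis; its two inductive steps
  match what the germ condition supplies, a straight piece after t and a straight piece before t.
  Measurability is delicate because neither the set of points with a trajectory nor the set of
  returning points is shown to be Borel. Hence existence of trajectories is kept as a separate
  almost-everywhere condition, openness of returns is claimed only relative to the points that have
  a trajectory, and failure to return is measured from outside. Moreover the velocity jumps at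
  collisions, so a return at a collision time has to be delayed slightly before continuity can be
  applied to it.\<close>

text \<open>Consider the infimum of the counterexamples: \<open>start\<close> or \<open>left\<close>
  shows that it is not one itself, and \<open>right\<close> then leaves a gap above it.\<close>

lemma real_induction:
  fixes P :: "real \<Rightarrow> bool"
  assumes start: "P a"
    and right: "\<And>t. a \<le> t \<Longrightarrow> t < b \<Longrightarrow> (\<And>s. a \<le> s \<Longrightarrow> s \<le> t \<Longrightarrow> P s) \<Longrightarrow>
                  \<exists>\<epsilon>>0. \<forall>h\<in>{0<..<\<epsilon>}. t + h < b \<longrightarrow> P (t + h)"
    and left: "\<And>t. a < t \<Longrightarrow> t < b \<Longrightarrow> (\<And>s. a \<le> s \<Longrightarrow> s < t \<Longrightarrow> P s) \<Longrightarrow> P t"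
    and "a \<le> t" "t < b"
  shows "P t"
proof (rule ccontr)
  assume "\<not> P t"
  define B where "B = {s. a \<le> s \<and> s < b \<and> \<not> P s}"
  have tB: "t \<in> B" using \<open>\<not> P t\<close> assms(4,5) by (simp add: B_def)
  have bdd: "bdd_below B" by (rule bdd_belowI[of _ a]) (simp add: B_def)
  define i where "i = Inf B"
  have ai: "a \<le> i" unfolding i_def using tB by (intro cInf_greatest) (auto simp: B_def)
  have it: "i \<le> t" unfolding i_def using tB bdd by (rule cInf_lower)
  have below: "P s" if "a \<le> s" "s < i" for s
  proof (rule ccontr)
    assume "\<not> P s"
    hence "s \<in> B" using that it assms(5) by (simp add: B_def)
    hence "i \<le> s" unfolding i_def using bdd by (rule cInf_lower)
    thus False using that by simp
  qed
  have "P i"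
    using left[of i] below start ai it assms(5) by (cases "a = i") auto
  hence upto: "P s" if "a \<le> s" "s \<le> i" for s
    using below that by (cases "s = i") auto
  obtain \<epsilon> where \<epsilon>: "\<epsilon> > 0" "\<And>h. h \<in> {0<..<\<epsilon>} \<Longrightarrow> i + h < b \<Longrightarrow> P (i + h)"
    using right[of i] upto ai it assms(5) by fastforce
  have "i + \<epsilon> \<le> i" unfolding i_def
  proof (rule cInf_greatest)
    show "B \<noteq> {}" using tB by auto
    fix s assume s: "s \<in> B"
    hence "i \<le> s" unfolding i_def using bdd by (intro cInf_lower)
    moreover have "s \<noteq> i" using s \<open>P i\<close> by (auto simp: B_def)
    moreover have "\<not> (i < s \<and> s < i + \<epsilon>)" using \<epsilon>(2)[of "s - i"] s by (auto simp: B_def)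
    ultimately show "Inf B + \<epsilon> \<le> s" by (auto simp: i_def)
  qed
  thus False using \<epsilon> by simp
qed

definition regular_at :: "configuration \<Rightarrow> (real \<Rightarrow> vec) \<Rightarrow> (real \<Rightarrow> vec) \<Rightarrow> real \<Rightarrow> bool" where
  "regular_at W q v t \<longleftrightarrow>
     q t \<in> table W \<and> q t \<notin> corners W \<and> norm (v t) = 1 \<and>
       (\<exists>u. v t = outgoing_velocity W (q t) u \<and>
         (\<exists>\<epsilon>>0.
           (\<forall>s\<in>{0..<\<epsilon>}. q (t + s) = q t + s *\<^sub>R v t \<and> v (t + s) = v t) \<and>
           (\<forall>s\<in>{0<..<\<epsilon>}. q (t - s) = q t - s *\<^sub>R u \<and> v (t - s) = u)))"

text \<open>The germ condition looks to both sides of each t in I. On \<open>{a..<b}\<close> it thus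
  also describes a short piece before a, while values away from I stay arbitrary; this allows
  cutting and gluing.\<close>

definition trajectory_on ::
    "configuration \<Rightarrow> real set \<Rightarrow> (real \<Rightarrow> vec) \<Rightarrow> (real \<Rightarrow> vec) \<Rightarrow> bool" where
  "trajectory_on W I q v \<longleftrightarrow> (\<forall>t\<in>I. regular_at W q v t)"

lemma billiard_trajectory_iff: "billiard_trajectory W q v \<longleftrightarrow> trajectory_on W UNIV q v"
  by (simp add: billiard_trajectory_def trajectory_on_def regular_at_def)

lemma trajectory_on_mono: "trajectory_on W J q v \<Longrightarrow> I \<subseteq> J \<Longrightarrow> trajectory_on W I q v"
  by (auto simp: trajectory_on_def)

lemma outgoing_velocity_involution [simp]:
  "outgoing_velocity W p (outgoing_velocity W p u) = u"
  by (simp add: outgoing_velocity_def)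

lemma norm_outgoing_velocity [simp]: "norm (outgoing_velocity W p u) = norm u"
  by (simp add: outgoing_velocity_def norm_prod_def)

lemma regular_atE:
  assumes "regular_at W q v t"
  obtains u \<epsilon> where "\<epsilon> > 0" "v t = outgoing_velocity W (q t) u"
    "u = outgoing_velocity W (q t) (v t)" "norm (v t) = 1" "norm u = 1"
    "\<And>h. 0 \<le> h \<Longrightarrow> h < \<epsilon> \<Longrightarrow> q (t + h) = q t + h *\<^sub>R v t \<and> v (t + h) = v t"
    "\<And>h. 0 < h \<Longrightarrow> h < \<epsilon> \<Longrightarrow> q (t - h) = q t - h *\<^sub>R u \<and> v (t - h) = u"
proof -
  from assms obtain u \<epsilon> where
    u: "v t = outgoing_velocity W (q t) u" "norm (v t) = 1" "\<epsilon> > 0"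
    and "\<forall>s\<in>{0..<\<epsilon>}. q (t + s) = q t + s *\<^sub>R v t \<and> v (t + s) = v t"
    "\<forall>s\<in>{0<..<\<epsilon>}. q (t - s) = q t - s *\<^sub>R u \<and> v (t - s) = u"
    unfolding regular_at_def by blast
  moreover have "u = outgoing_velocity W (q t) (v t)" using u by simp
  moreover have "norm u = 1" using u by (metis norm_outgoing_velocity)
  ultimately show thesis by (intro that[of \<epsilon> u]) auto
qed

lemma regular_at_cong:
  assumes "regular_at W q v t" and "e > 0"
    and "\<And>s. \<bar>s - t\<bar> < e \<Longrightarrow> q' s = q s \<and> v' s = v s"
  shows "regular_at W q' v' t"
proof -
  from assms(1) obtain u \<epsilon> where
    u: "v t = outgoing_velocity W (q t) u" "norm (v t) = 1" "\<epsilon> > 0"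
      "\<forall>s\<in>{0..<\<epsilon>}. q (t + s) = q t + s *\<^sub>R v t \<and> v (t + s) = v t"
      "\<forall>s\<in>{0<..<\<epsilon>}. q (t - s) = q t - s *\<^sub>R u \<and> v (t - s) = u"
    and tab: "q t \<in> table W" "q t \<notin> corners W"
    unfolding regular_at_def by blast
  have eq: "q' t = q t" "v' t = v t" using assms(3)[of t] assms(2) by auto
  show ?thesis unfolding regular_at_def eq
  proof (intro conjI exI[of _ u] exI[of _ "min \<epsilon> e"] ballI)
    fix s assume "s \<in> {0..<min \<epsilon> e}"
    thus "q' (t + s) = q t + s *\<^sub>R v t" "v' (t + s) = v t" using u assms(3)[of "t + s"] by auto
  next
    fix s assume "s \<in> {0<..<min \<epsilon> e}"
    thus "q' (t - s) = q t - s *\<^sub>R u" "v' (t - s) = u" using u assms(3)[of "t - s"] by auto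
  qed (use u tab assms(2) in auto)
qed

lemma regular_at_shift: "regular_at W q v (t + c) \<Longrightarrow> regular_at W (\<lambda>s. q (s + c)) (\<lambda>s. v (s + c)) t"
  unfolding regular_at_def by (simp add: algebra_simps)

section \<open>Unit speed and uniqueness of trajectories\<close>

text \<open>Both straight pieces at t have unit velocity. The bound confines a trajectory of bounded
  duration to a ball, hence to the influence of finitely many obstacles.\<close>

lemma trajectory_nonexpanding:
  assumes "trajectory_on W {a..<b} q v" "a \<le> t" "t < b"
  shows "norm (q t - q a) \<le> t - a"
proof (rule real_induction[where a = a and b = b and t = t and P = "\<lambda>t. norm (q t - q a) \<le> t - a"])
  fix t assume t: "a \<le> t" "t < b" and P: "\<And>s. a \<le> s \<Longrightarrow> s \<le> t \<Longrightarrow> norm (q s - q a) \<le> s - a"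
  from t assms(1) have "regular_at W q v t" by (simp add: trajectory_on_def)
  then obtain u \<epsilon> where "\<epsilon> > 0" and n: "norm (v t) = 1"
    and q: "\<And>h. 0 \<le> h \<Longrightarrow> h < \<epsilon> \<Longrightarrow> q (t + h) = q t + h *\<^sub>R v t \<and> v (t + h) = v t"
    by (elim regular_atE) metis
  have "norm (q (t + h) - q a) \<le> t + h - a" if "0 < h" "h < \<epsilon>" for h
  proof -
    have "q (t + h) - q a = (q t - q a) + h *\<^sub>R v t" using q[of h] that by simp
    also have "norm \<dots> \<le> (t - a) + h"
      using P[of t] t n that by (intro norm_triangle_le add_mono) auto
    finally show ?thesis by simp
  qed
  thus "\<exists>\<epsilon>>0. \<forall>h\<in>{0<..<\<epsilon>}. t + h < b \<longrightarrow> norm (q (t + h) - q a) \<le> t + h - a"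
    using \<open>\<epsilon> > 0\<close> by auto
next
  fix t assume t: "a < t" "t < b" and P: "\<And>s. a \<le> s \<Longrightarrow> s < t \<Longrightarrow> norm (q s - q a) \<le> s - a"
  from t assms(1) have "regular_at W q v t" by (simp add: trajectory_on_def)
  then obtain u \<epsilon> where "\<epsilon> > 0" and n: "norm u = 1"
    and q: "\<And>h. 0 < h \<Longrightarrow> h < \<epsilon> \<Longrightarrow> q (t - h) = q t - h *\<^sub>R u \<and> v (t - h) = u"
    by (elim regular_atE) metis
  define h where "h = min (\<epsilon> / 2) (t - a)"
  have h: "0 < h" "h < \<epsilon>" "h \<le> t - a" using \<open>\<epsilon> > 0\<close> t by (auto simp: h_def)
  have "q t - q a = (q (t - h) - q a) + h *\<^sub>R u" using q[of h] h by simp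
  also have "norm \<dots> \<le> (t - h - a) + h"
    using P[of "t - h"] n h by (intro norm_triangle_le add_mono) auto
  finally show "norm (q t - q a) \<le> t - a" by simp
qed (use assms in auto)

text \<open>Just before t the paths agree, so their incoming velocities agree, then their positions
  at t; the outgoing velocity is a function of these two. After t the motion is straight.\<close>

lemma trajectory_unique_forward:
  assumes traj: "trajectory_on W {a..<b} q v" "trajectory_on W {a..<b} q' v'"
    and init: "q a = q' a" "v a = v' a" and t: "a \<le> t" "t < b"
  shows "q t = q' t \<and> v t = v' t"
proof (rule real_induction[where a = a and b = b and t = t and P = "\<lambda>t. q t = q' t \<and> v t = v' t"])
  fix t assume t: "a \<le> t" "t < b" and P: "\<And>s. a \<le> s \<Longrightarrow> s \<le> t \<Longrightarrow> q s = q' s \<and> v s = v' s"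
  have reg: "regular_at W q v t" "regular_at W q' v' t" using t traj by (auto simp: trajectory_on_def)
  obtain \<epsilon>1 where 1: "\<epsilon>1 > 0"
     "\<And>h. 0 \<le> h \<Longrightarrow> h < \<epsilon>1 \<Longrightarrow> q (t + h) = q t + h *\<^sub>R v t \<and> v (t + h) = v t"
    using reg(1) by (elim regular_atE) metis
  obtain \<epsilon>2 where 2: "\<epsilon>2 > 0"
     "\<And>h. 0 \<le> h \<Longrightarrow> h < \<epsilon>2 \<Longrightarrow> q' (t + h) = q' t + h *\<^sub>R v' t \<and> v' (t + h) = v' t"
    using reg(2) by (elim regular_atE) metis
  show "\<exists>\<epsilon>>0. \<forall>h\<in>{0<..<\<epsilon>}. t + h < b \<longrightarrow> q (t + h) = q' (t + h) \<and> v (t + h) = v' (t + h)"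
    using 1 2 P[of t] t by (intro exI[of _ "min \<epsilon>1 \<epsilon>2"]) auto
next
  fix t assume t: "a < t" "t < b" and P: "\<And>s. a \<le> s \<Longrightarrow> s < t \<Longrightarrow> q s = q' s \<and> v s = v' s"
  have reg: "regular_at W q v t" "regular_at W q' v' t" using t traj by (auto simp: trajectory_on_def)
  obtain \<epsilon>1 u1 where 1: "\<epsilon>1 > 0" "v t = outgoing_velocity W (q t) u1"
     "\<And>h. 0 < h \<Longrightarrow> h < \<epsilon>1 \<Longrightarrow> q (t - h) = q t - h *\<^sub>R u1 \<and> v (t - h) = u1"
    using reg(1) by (elim regular_atE) metis
  obtain \<epsilon>2 u2 where 2: "\<epsilon>2 > 0" "v' t = outgoing_velocity W (q' t) u2"
     "\<And>h. 0 < h \<Longrightarrow> h < \<epsilon>2 \<Longrightarrow> q' (t - h) = q' t - h *\<^sub>R u2 \<and> v' (t - h) = u2"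
    using reg(2) by (elim regular_atE) metis
  define h where "h = min (min \<epsilon>1 \<epsilon>2 / 2) (t - a)"
  have h: "0 < h" "h < \<epsilon>1" "h < \<epsilon>2" "h \<le> t - a" using 1(1) 2(1) t by (auto simp: h_def)
  have "u1 = u2" using 1(3)[of h] 2(3)[of h] P[of "t - h"] h by auto
  moreover have "q t = q' t" using 1(3)[of h] 2(3)[of h] P[of "t - h"] h calculation by auto
  ultimately show "q t = q' t \<and> v t = v' t" using 1(2) 2(2) by simp
qed (use init t in auto)

text \<open>Reversing time does not directly give a trajectory, since the velocity at a collision
  must be the outgoing one. The induction is therefore repeated in -t; the incoming velocity is
  recovered from \<open>v t\<close> because \<open>outgoing_velocity\<close> is an
  involution.\<close>

lemma trajectory_unique_backward:
  assumes traj: "trajectory_on W {b<..a} q v" "trajectory_on W {b<..a} q' v'"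
    and init: "q a = q' a" "v a = v' a" and t: "b < t" "t \<le> a"
  shows "q t = q' t \<and> v t = v' t"
proof -
  let ?P = "\<lambda>s. q (- s) = q' (- s) \<and> v (- s) = v' (- s)"
  have "?P (- t)"
  proof (rule real_induction[where a = "- a" and b = "- b" and t = "- t" and P = ?P])
    fix t assume t: "- a \<le> t" "t < - b" and P: "\<And>s. - a \<le> s \<Longrightarrow> s \<le> t \<Longrightarrow> ?P s"
    have reg: "regular_at W q v (- t)" "regular_at W q' v' (- t)"
      using t traj by (auto simp: trajectory_on_def)
    obtain \<epsilon>1 u1 where 1: "\<epsilon>1 > 0" "u1 = outgoing_velocity W (q (- t)) (v (- t))"
       "\<And>h. 0 < h \<Longrightarrow> h < \<epsilon>1 \<Longrightarrow> q (- t - h) = q (- t) - h *\<^sub>R u1 \<and> v (- t - h) = u1"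
      using reg(1) by (elim regular_atE) metis
    obtain \<epsilon>2 u2 where 2: "\<epsilon>2 > 0" "u2 = outgoing_velocity W (q' (- t)) (v' (- t))"
       "\<And>h. 0 < h \<Longrightarrow> h < \<epsilon>2 \<Longrightarrow> q' (- t - h) = q' (- t) - h *\<^sub>R u2 \<and> v' (- t - h) = u2"
      using reg(2) by (elim regular_atE) metis
    have "?P (t + h)" if "0 < h" "h < min \<epsilon>1 \<epsilon>2" for h
    proof -
      have e: "- (t + h) = - t - h" by simp
      show ?thesis unfolding e using 1(2) 1(3)[of h] 2(2) 2(3)[of h] P[of t] t that by simp
    qed
    thus "\<exists>\<epsilon>>0. \<forall>h\<in>{0<..<\<epsilon>}. t + h < - b \<longrightarrow> ?P (t + h)"
      using 1(1) 2(1) by (intro exI[of _ "min \<epsilon>1 \<epsilon>2"]) auto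
  next
    fix t assume t: "- a < t" "t < - b" and P: "\<And>s. - a \<le> s \<Longrightarrow> s < t \<Longrightarrow> ?P s"
    have reg: "regular_at W q v (- t)" "regular_at W q' v' (- t)"
      using t traj by (auto simp: trajectory_on_def)
    obtain \<epsilon>1 where 1: "\<epsilon>1 > 0"
       "\<And>h. 0 \<le> h \<Longrightarrow> h < \<epsilon>1 \<Longrightarrow> q (- t + h) = q (- t) + h *\<^sub>R v (- t) \<and> v (- t + h) = v (- t)"
      using reg(1) by (elim regular_atE) metis
    obtain \<epsilon>2 where 2: "\<epsilon>2 > 0"
       "\<And>h. 0 \<le> h \<Longrightarrow> h < \<epsilon>2 \<Longrightarrow> q' (- t + h) = q' (- t) + h *\<^sub>R v' (- t) \<and> v' (- t + h) = v' (- t)"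
      using reg(2) by (elim regular_atE) metis
    define h where "h = min (min \<epsilon>1 \<epsilon>2 / 2) (t + a)"
    have h: "0 < h" "h < \<epsilon>1" "h < \<epsilon>2" "h \<le> t + a" using 1(1) 2(1) t by (auto simp: h_def)
    have e: "- (t - h) = - t + h" by simp
    have Ph: "q (- t + h) = q' (- t + h) \<and> v (- t + h) = v' (- t + h)"
      using P[of "t - h"] h unfolding e by auto
    have "v (- t) = v' (- t)" using 1(2)[of h] 2(2)[of h] Ph h by auto
    moreover have "q (- t) = q' (- t)" using 1(2)[of h] 2(2)[of h] Ph h calculation by auto
    ultimately show "?P t" by simp
  qed (use init t in auto)
  thus ?thesis by simp
qed

lemma trajectory_unique:
  assumes traj: "trajectory_on W {-m<..<m} q v" "trajectory_on W {-m<..<m} q' v'"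
    and init: "q 0 = q' 0" "v 0 = v' 0" and t: "\<bar>t\<bar> < m"
  shows "q t = q' t \<and> v t = v' t"
proof (cases "0 \<le> t")
  case True
  have "{0..<m} \<subseteq> {-m<..<m}" using t by auto
  thus ?thesis using trajectory_unique_forward[OF traj[THEN trajectory_on_mono] init] True t by auto
next
  case False
  have "{-m<..0} \<subseteq> {-m<..<m}" using t by auto
  thus ?thesis using trajectory_unique_backward[OF traj[THEN trajectory_on_mono] init] False t by auto
qed

section \<open>Complete trajectories from bounded time windows\<close>

definition has_trajectory :: "configuration \<Rightarrow> real \<Rightarrow> vec \<times> vec \<Rightarrow> bool" where
  "has_trajectory W m x \<longleftrightarrow> (\<exists>q v. trajectory_on W {-m<..<m} q v \<and> (q 0, v 0) = x)"

text \<open>By uniqueness the trajectories on growing windows extend one another and glue to a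
  complete one, so regularity of a point is a countable conjunction of conditions over bounded
  time.\<close>

lemma regular_points_iff: "x \<in> regular_points W \<longleftrightarrow> (\<forall>m::nat. has_trajectory W m x)"
proof
  assume "x \<in> regular_points W"
  thus "\<forall>m::nat. has_trajectory W m x"
    unfolding regular_points_def has_trajectory_def billiard_trajectory_iff
    using trajectory_on_mono by blast
next
  assume "\<forall>m::nat. has_trajectory W m x"
  then obtain q v :: "nat \<Rightarrow> real \<Rightarrow> vec"
    where qv: "\<And>m. trajectory_on W {-real m<..<real m} (q m) (v m)" "\<And>m. (q m 0, v m 0) = x"
    unfolding has_trajectory_def by metis
  have agree: "q k t = q l t \<and> v k t = v l t" if "\<bar>t\<bar> < real k" "k \<le> l" for k l :: nat and t
    using that by (intro trajectory_unique[OF qv(1)[of k] trajectory_on_mono[OF qv(1)[of l]]])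
      (use qv(2)[of k] qv(2)[of l] in auto)
  define N where "N t = nat \<lceil>\<bar>t\<bar>\<rceil> + 1" for t :: real
  have N: "\<bar>t\<bar> < real (N t)" for t unfolding N_def by linarith
  define Q V where "Q t = q (N t) t" and "V t = v (N t) t" for t
  have QV: "Q t = q l t \<and> V t = v l t" if "\<bar>t\<bar> < real l" for l t
    using agree[of t l "N t"] agree[of t "N t" l] that N[of t] by (auto simp: Q_def V_def dest: le_cases)
  have "regular_at W Q V t" for t
  proof (rule regular_at_cong)
    \<comment> \<open>The window is enlarged by 1 so that it contains the whole interval of radius 1
      around t: agreement is needed near t, not only at t.\<close>
    show "regular_at W (q (N t + 1)) (v (N t + 1)) t"
    proof -
      have "t \<in> {- real (N t + 1)<..<real (N t + 1)}" using N[of t] by (simp add: abs_less_iff)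
      thus ?thesis using qv(1)[of "N t + 1"] unfolding trajectory_on_def by blast
    qed
    show "Q s = q (N t + 1) s \<and> V s = v (N t + 1) s" if "\<bar>s - t\<bar> < 1" for s
      using that N[of t] by (intro QV) auto
  qed simp
  hence "trajectory_on W UNIV Q V" by (simp add: trajectory_on_def)
  moreover have "(Q 0, V 0) = x" using qv(2) by (simp add: Q_def V_def)
  ultimately show "x \<in> regular_points W"
    unfolding regular_points_def billiard_trajectory_iff by blast
qed

lemma billiard_flow_eq:
  assumes "billiard_trajectory W q v"
  shows "billiard_flow W t (q 0, v 0) = (q t, v t)"
  unfolding billiard_flow_def
proof (rule the_equality)
  fix y assume "\<exists>q' v'. billiard_trajectory W q' v' \<and> (q' 0, v' 0) = (q 0, v 0) \<and> (q' t, v' t) = y"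
  then obtain q' v' where "trajectory_on W UNIV q' v'" "(q' 0, v' 0) = (q 0, v 0)" "(q' t, v' t) = y"
    by (auto simp: billiard_trajectory_iff)
  thus "y = (q t, v t)"
    using trajectory_unique[where m = "\<bar>t\<bar> + 1" and q = q and v = v and q' = q' and v' = v' and W = W]
      assms trajectory_on_mono unfolding billiard_trajectory_iff by (metis Pair_inject less_add_one subset_UNIV)
qed (use assms in blast)

text \<open>A single index n can bound both the time and the radius, because both requirements get
  stronger as n grows and the balls of radius \<open>1 / (n + 1)\<close> form a neighbourhood
  base.\<close>

lemma recurrent_point_iff:
  "recurrent_point (top_of_set (regular_points W)) (billiard_flow W) x \<longleftrightarrow>
     (\<exists>q v. billiard_trajectory W q v \<and> (q 0, v 0) = x \<and>
       (\<forall>n::nat. \<exists>T>real n. dist (q T, v T) x < 1 / (n + 1)))" (is "?L \<longleftrightarrow> ?R")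
proof
  assume L: ?L
  hence "x \<in> regular_points W" by (simp add: recurrent_point_def)
  then obtain q v where qv: "billiard_trajectory W q v" "(q 0, v 0) = x"
    by (auto simp: regular_points_def)
  have "\<exists>T>real n. dist (q T, v T) x < 1 / (n + 1)" for n :: nat
  proof -
    have "openin (top_of_set (regular_points W)) (regular_points W \<inter> ball x (1 / (n + 1)))"
      by (simp add: openin_open_Int)
    moreover have "x \<in> regular_points W \<inter> ball x (1 / (n + 1))" using \<open>x \<in> regular_points W\<close> by simp
    \<comment> \<open>The time bound is n + 1 because \<open>recurrent_point\<close> only speaks of
      positive \<open>T0\<close> and n may be 0.\<close>
    ultimately obtain T where "T > real n + 1" "billiard_flow W T x \<in> regular_points W \<inter> ball x (1 / (n + 1))"
      using L unfolding recurrent_point_def by (metis add_nonneg_pos of_nat_0_le_iff zero_less_one)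
    thus ?thesis using billiard_flow_eq[OF qv(1), of T] qv(2)
      by (intro exI[of _ T]) (auto simp: dist_commute)
  qed
  thus ?R using qv by blast
next
  assume ?R
  then obtain q v where qv: "billiard_trajectory W q v" "(q 0, v 0) = x"
    and rec: "\<And>n::nat. \<exists>T>real n. dist (q T, v T) x < 1 / (n + 1)" by blast
  show ?L unfolding recurrent_point_def
  proof (intro conjI allI impI)
    show "x \<in> topspace (top_of_set (regular_points W))" using qv by (auto simp: regular_points_def)
    fix U and T0 :: real
    assume U: "openin (top_of_set (regular_points W)) U \<and> x \<in> U \<and> 0 < T0"
    then obtain V where V: "open V" "U = regular_points W \<inter> V" by (auto simp: openin_open)
    then obtain e where e: "e > 0" "ball x e \<subseteq> V" using U open_contains_ball by blast
    obtain n :: nat where n: "T0 + 1 / e < n" using reals_Archimedean2 by blast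
    have "1 / e > 0" using e by simp
    hence "1 / e < n + 1" "T0 < n" using n U by linarith+
    have "1 / (real n + 1) < e" using e \<open>1 / e < n + 1\<close> by (simp add: field_simps)
    moreover obtain T where "T > real n" "dist (q T, v T) x < 1 / (real n + 1)"
      using rec[of n] by (auto simp: add.commute)
    ultimately have T: "T > T0" "dist (q T, v T) x < e" using \<open>T0 < n\<close> by linarith+
    \<comment> \<open>Neighbourhoods are relative to the regular points, so the point reached at
      time T must be regular too; it starts the trajectory shifted by T.\<close>
    have "trajectory_on W UNIV (\<lambda>s. q (s + T)) (\<lambda>s. v (s + T))"
      using qv(1) regular_at_shift unfolding billiard_trajectory_iff trajectory_on_def by blast
    hence "(q T, v T) \<in> regular_points W"
      unfolding regular_points_def billiard_trajectory_iff by force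
    thus "\<exists>T>T0. billiard_flow W T x \<in> U"
      using T e V billiard_flow_eq[OF qv(1), of T] qv(2)
      by (intro exI[of _ T]) (auto simp: dist_commute)
  qed
qed

section \<open>Local geometry of a table\<close>

definition admissible :: "configuration \<Rightarrow> bool" where
  "admissible W \<longleftrightarrow> range W \<subseteq> unit_square \<union> {(0, 0)}"

definition sides :: "configuration \<Rightarrow> vec set" where
  "sides W = vertical_sides W \<union> horizontal_sides W"

lemma outgoing_velocity_off_sides: "p \<notin> sides W \<Longrightarrow> outgoing_velocity W p u = u"
  by (simp add: sides_def outgoing_velocity_def)

lemma admissibleD:
  assumes "admissible W"
  shows "fst (W ij) < 1" "snd (W ij) < 1" "0 \<le> fst (W ij)" "0 \<le> snd (W ij)"
    "W ij \<noteq> (0, 0) \<Longrightarrow> 0 < fst (W ij)" "W ij \<noteq> (0, 0) \<Longrightarrow> 0 < snd (W ij)"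
proof -
  have "W ij \<in> unit_square \<union> {(0, 0)}" using assms by (auto simp: admissible_def)
  thus "fst (W ij) < 1" "snd (W ij) < 1" "0 \<le> fst (W ij)" "0 \<le> snd (W ij)"
    "W ij \<noteq> (0, 0) \<Longrightarrow> 0 < fst (W ij)" "W ij \<noteq> (0, 0) \<Longrightarrow> 0 < snd (W ij)"
    by (auto simp: unit_square_def)
qed

lemma int_eq_of_close:
  fixes i j :: int
  assumes "\<bar>x - real_of_int i\<bar> < 1 / 2" "\<bar>x - real_of_int j\<bar> < 1 / 2"
  shows "i = j"
  using assms by linarith

lemma table_iff:
  "x \<in> table W \<longleftrightarrow> (\<forall>i j. W (i, j) \<noteq> (0, 0) \<longrightarrow>
     \<not> (\<bar>fst x - of_int i\<bar> < fst (W (i, j)) / 2 \<and> \<bar>snd x - of_int j\<bar> < snd (W (i, j)) / 2))"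
  by (cases x) (auto simp: table_def obstacle_sites_def)

lemma vertical_sides_iff:
  "x \<in> vertical_sides W \<longleftrightarrow> (\<exists>i j. W (i, j) \<noteq> (0, 0) \<and>
     \<bar>fst x - of_int i\<bar> = fst (W (i, j)) / 2 \<and> \<bar>snd x - of_int j\<bar> < snd (W (i, j)) / 2)"
  by (cases x) (auto simp: vertical_sides_def obstacle_sites_def)

lemma horizontal_sides_iff:
  "x \<in> horizontal_sides W \<longleftrightarrow> (\<exists>i j. W (i, j) \<noteq> (0, 0) \<and>
     \<bar>fst x - of_int i\<bar> < fst (W (i, j)) / 2 \<and> \<bar>snd x - of_int j\<bar> = snd (W (i, j)) / 2)"
  by (cases x) (auto simp: horizontal_sides_def obstacle_sites_def)

lemma corners_iff:
  "x \<in> corners W \<longleftrightarrow> (\<exists>i j. W (i, j) \<noteq> (0, 0) \<and>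
     \<bar>fst x - of_int i\<bar> = fst (W (i, j)) / 2 \<and> \<bar>snd x - of_int j\<bar> = snd (W (i, j)) / 2)"
  by (cases x) (auto simp: corners_def obstacle_sites_def)

lemmas table_geometry_iff = table_iff vertical_sides_iff horizontal_sides_iff corners_iff

lemma eventually_coordinate_less:
  fixes p :: vec
  shows "\<bar>fst p - a\<bar> < r \<Longrightarrow> \<forall>\<^sub>F x in nhds p. \<bar>fst x - a\<bar> < r"
    and "\<bar>snd p - a\<bar> < r \<Longrightarrow> \<forall>\<^sub>F x in nhds p. \<bar>snd x - a\<bar> < r"
    and "r < \<bar>fst p - a\<bar> \<Longrightarrow> \<forall>\<^sub>F x in nhds p. r < \<bar>fst x - a\<bar>"
    and "r < \<bar>snd p - a\<bar> \<Longrightarrow> \<forall>\<^sub>F x in nhds p. r < \<bar>snd x - a\<bar>"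
proof -
  have "((\<lambda>x. \<bar>fst x - a\<bar>) \<longlongrightarrow> \<bar>fst p - a\<bar>) (nhds p)" "((\<lambda>x. \<bar>snd x - a\<bar>) \<longlongrightarrow> \<bar>snd p - a\<bar>) (nhds p)"
    by (intro tendsto_intros filterlim_ident)+
  thus "\<bar>fst p - a\<bar> < r \<Longrightarrow> \<forall>\<^sub>F x in nhds p. \<bar>fst x - a\<bar> < r"
    "\<bar>snd p - a\<bar> < r \<Longrightarrow> \<forall>\<^sub>F x in nhds p. \<bar>snd x - a\<bar> < r"
    "r < \<bar>fst p - a\<bar> \<Longrightarrow> \<forall>\<^sub>F x in nhds p. r < \<bar>fst x - a\<bar>"
    "r < \<bar>snd p - a\<bar> \<Longrightarrow> \<forall>\<^sub>F x in nhds p. r < \<bar>snd x - a\<bar>"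
    by (auto dest: order_tendstoD)
qed

text \<open>Near \<open>p\<close> the table is the half plane \<open>c \<le> x \<bullet> n\<close>, reflecting along the line \<open>x \<bullet> n = c\<close>.
  A point away from all obstacles fits this description with a line that does not come near it.\<close>

definition half_plane_at :: "configuration \<Rightarrow> vec \<Rightarrow> real \<Rightarrow> vec \<Rightarrow> bool" where
  "half_plane_at W n c x \<longleftrightarrow> (x \<in> table W \<longrightarrow> c \<le> x \<bullet> n) \<and> (x \<in> sides W \<longleftrightarrow> x \<bullet> n = c) \<and>
     (x \<in> sides W \<longrightarrow> (\<forall>u. outgoing_velocity W x u = u - (2 * (u \<bullet> n)) *\<^sub>R n))"

lemma half_plane_off_sides:
  assumes W: "admissible W" and p: "p \<in> table W" "p \<notin> corners W" "p \<notin> sides W"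
  shows "\<exists>n c. norm n = 1 \<and> (\<forall>\<^sub>F x in nhds p. half_plane_at W n c x)"
proof -
  \<comment> \<open>An obstacle touching a point whose coordinates differ from those of p by less
    than 1 has its centre less than 2 away from p in each coordinate; with rounding, 3 is ample.
    Finiteness of \<open>J\<close> allows one common neighbourhood.\<close>
  define J where "J = {\<lfloor>fst p\<rfloor> - 3..\<lfloor>fst p\<rfloor> + 3} \<times> {\<lfloor>snd p\<rfloor> - 3..\<lfloor>snd p\<rfloor> + 3}"
  have "\<forall>\<^sub>F x in nhds p. \<forall>ij\<in>J. W ij \<noteq> (0, 0) \<longrightarrow>
      fst (W ij) / 2 < \<bar>fst x - of_int (fst ij)\<bar> \<or> snd (W ij) / 2 < \<bar>snd x - of_int (snd ij)\<bar>"
  proof (intro eventually_ball_finite ballI)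
    fix ij assume "ij \<in> J"
    obtain i j where ij: "ij = (i, j)" by (cases ij)
    show "\<forall>\<^sub>F x in nhds p. W ij \<noteq> (0, 0) \<longrightarrow>
      fst (W ij) / 2 < \<bar>fst x - of_int (fst ij)\<bar> \<or> snd (W ij) / 2 < \<bar>snd x - of_int (snd ij)\<bar>"
    proof (cases "W ij = (0, 0)")
      case False
      hence "fst (W ij) / 2 < \<bar>fst p - of_int i\<bar> \<or> snd (W ij) / 2 < \<bar>snd p - of_int j\<bar>"
        using p unfolding sides_def Un_iff table_geometry_iff ij
        by (metis linorder_less_linear)
      thus ?thesis
      proof
        assume "fst (W ij) / 2 < \<bar>fst p - of_int i\<bar>"
        from eventually_coordinate_less(3)[OF this] show ?thesis by eventually_elim (simp add: ij)
      next
        assume "snd (W ij) / 2 < \<bar>snd p - of_int j\<bar>"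
        from eventually_coordinate_less(4)[OF this] show ?thesis by eventually_elim (simp add: ij)
      qed
    qed simp
  qed (simp add: J_def)
  moreover have "\<forall>\<^sub>F x in nhds p. \<bar>fst x - fst p\<bar> < 1" "\<forall>\<^sub>F x in nhds p. \<bar>snd x - snd p\<bar> < 1"
    by (intro eventually_coordinate_less; simp)+
  ultimately have "\<forall>\<^sub>F x in nhds p. half_plane_at W (1, 0) (fst p - 1) x"
  proof eventually_elim
    case (elim x)
    have "x \<notin> sides W"
    proof
      assume "x \<in> sides W"
      then obtain i j where *: "W (i, j) \<noteq> (0, 0)" "\<bar>fst x - of_int i\<bar> \<le> fst (W (i, j)) / 2"
        "\<bar>snd x - of_int j\<bar> \<le> snd (W (i, j)) / 2"
        unfolding sides_def Un_iff table_geometry_iff by fastforce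
      have "\<bar>fst x - of_int i\<bar> < 1" "\<bar>snd x - of_int j\<bar> < 1"
        using * admissibleD(1,2)[OF W, of "(i, j)"] by linarith+
      hence "(i, j) \<in> J" using elim(2,3) unfolding J_def mem_Times_iff fst_conv snd_conv atLeastAtMost_iff
        by (intro conjI) linarith+
      thus False using elim(1) * by fastforce
    qed
    thus ?case using elim(2) by (auto simp: half_plane_at_def inner_prod_def)
  qed
  thus ?thesis by (intro exI[of _ "(1, 0)"] exI[of _ "fst p - 1"]) (simp add: norm_prod_def)
qed

text \<open>Obstacles have sides shorter than 1, so each fits into the open unit cell around its
  site and only the obstacle carrying p matters nearby. The sign \<sigma> makes
  \<open>(\<sigma>, 0)\<close> point out of this obstacle.\<close>

lemma half_plane_vertical_side:
  assumes W: "admissible W" and p: "p \<in> vertical_sides W"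
  shows "\<exists>n c. norm n = 1 \<and> (\<forall>\<^sub>F x in nhds p. half_plane_at W n c x)"
proof -
  from p obtain i j where ij: "W (i, j) \<noteq> (0, 0)" "\<bar>fst p - of_int i\<bar> = fst (W (i, j)) / 2"
    "\<bar>snd p - of_int j\<bar> < snd (W (i, j)) / 2"
    unfolding table_geometry_iff by blast
  note a = admissibleD[OF W, of "(i, j)"]
  have a0: "0 < fst (W (i, j))" using a(5) ij by simp
  define \<sigma> where "\<sigma> = sgn (fst p - of_int i)"
  have \<sigma>: "\<sigma> = 1 \<and> fst p = of_int i + fst (W (i, j)) / 2 \<or> \<sigma> = -1 \<and> fst p = of_int i - fst (W (i, j)) / 2"
    using ij(2) a0 by (auto simp: \<sigma>_def abs_if split: if_splits)
  \<comment> \<open>The three conditions keep x in the cell of the obstacle, strictly between the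
    heights of the corners, and away from the opposite vertical side.\<close>
  have "\<forall>\<^sub>F x in nhds p. \<bar>fst x - of_int i\<bar> < 1 / 2" "\<forall>\<^sub>F x in nhds p. \<bar>snd x - of_int j\<bar> < snd (W (i, j)) / 2"
     "\<forall>\<^sub>F x in nhds p. \<bar>fst x - fst p\<bar> < fst (W (i, j)) / 2"
    using ij a a0 by (intro eventually_coordinate_less; simp)+
  hence "\<forall>\<^sub>F x in nhds p. half_plane_at W (\<sigma>, 0) (\<sigma> * fst p) x"
  proof eventually_elim
    case (elim x)
    have cell: "i' = i \<and> j' = j" if "\<bar>fst x - of_int i'\<bar> \<le> fst (W (i', j')) / 2"
      "\<bar>snd x - of_int j'\<bar> \<le> snd (W (i', j')) / 2" for i' j'
      using that elim admissibleD(1,2)[OF W, of "(i', j')"] a by (intro conjI int_eq_of_close[of "fst x"] int_eq_of_close[of "snd x"]) linarith+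
    have v: "x \<in> vertical_sides W \<longleftrightarrow> \<bar>fst x - of_int i\<bar> = fst (W (i, j)) / 2"
      unfolding table_geometry_iff using cell elim(2) ij by (metis order_le_less)
    have h: "x \<notin> horizontal_sides W"
      unfolding table_geometry_iff using cell elim(2) by (metis order_le_less order_less_irrefl)
    have on: "\<bar>fst x - of_int i\<bar> = fst (W (i, j)) / 2 \<longleftrightarrow> fst x = fst p"
      using \<sigma> elim(3) by (auto simp: abs_if split: if_splits)
    have "\<sigma> * fst p \<le> \<sigma> * fst x" if "x \<in> table W"
      using that \<sigma> elim(2,3) ij(1) unfolding table_geometry_iff by (fastforce simp: abs_if split: if_splits)
    moreover have "outgoing_velocity W x u = u - (2 * (u \<bullet> (\<sigma>, 0))) *\<^sub>R (\<sigma>, 0)" if "x \<in> sides W" for u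
      using that v h \<sigma> by (cases u) (auto simp: sides_def outgoing_velocity_def inner_prod_def)
    ultimately show ?case
      using \<sigma> v h on by (auto simp: half_plane_at_def sides_def inner_prod_def)
  qed
  thus ?thesis using \<sigma>
    by (intro exI[of _ "(\<sigma>, 0)"] exI[of _ "\<sigma> * fst p"]) (auto simp: norm_prod_def)
qed

lemma half_plane_horizontal_side:
  assumes W: "admissible W" and p: "p \<in> horizontal_sides W"
  shows "\<exists>n c. norm n = 1 \<and> (\<forall>\<^sub>F x in nhds p. half_plane_at W n c x)"
proof -
  from p obtain i j where ij: "W (i, j) \<noteq> (0, 0)" "\<bar>snd p - of_int j\<bar> = snd (W (i, j)) / 2"
    "\<bar>fst p - of_int i\<bar> < fst (W (i, j)) / 2"
    unfolding table_geometry_iff by blast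
  note a = admissibleD[OF W, of "(i, j)"]
  have a0: "0 < snd (W (i, j))" using a(6) ij by simp
  define \<sigma> where "\<sigma> = sgn (snd p - of_int j)"
  have \<sigma>: "\<sigma> = 1 \<and> snd p = of_int j + snd (W (i, j)) / 2 \<or> \<sigma> = -1 \<and> snd p = of_int j - snd (W (i, j)) / 2"
    using ij(2) a0 by (auto simp: \<sigma>_def abs_if split: if_splits)
  have "\<forall>\<^sub>F x in nhds p. \<bar>snd x - of_int j\<bar> < 1 / 2" "\<forall>\<^sub>F x in nhds p. \<bar>fst x - of_int i\<bar> < fst (W (i, j)) / 2"
     "\<forall>\<^sub>F x in nhds p. \<bar>snd x - snd p\<bar> < snd (W (i, j)) / 2"
    using ij a a0 by (intro eventually_coordinate_less; simp)+
  hence "\<forall>\<^sub>F x in nhds p. half_plane_at W (0, \<sigma>) (\<sigma> * snd p) x"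
  proof eventually_elim
    case (elim x)
    have cell: "i' = i \<and> j' = j" if "\<bar>fst x - of_int i'\<bar> \<le> fst (W (i', j')) / 2"
      "\<bar>snd x - of_int j'\<bar> \<le> snd (W (i', j')) / 2" for i' j'
      using that elim admissibleD(1,2)[OF W, of "(i', j')"] a by (intro conjI int_eq_of_close[of "fst x"] int_eq_of_close[of "snd x"]) linarith+
    have h: "x \<in> horizontal_sides W \<longleftrightarrow> \<bar>snd x - of_int j\<bar> = snd (W (i, j)) / 2"
      unfolding table_geometry_iff using cell elim(2) ij by (metis order_le_less)
    have v: "x \<notin> vertical_sides W"
      unfolding table_geometry_iff using cell elim(2) by (metis order_le_less order_less_irrefl)
    have on: "\<bar>snd x - of_int j\<bar> = snd (W (i, j)) / 2 \<longleftrightarrow> snd x = snd p"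
      using \<sigma> elim(3) by (auto simp: abs_if split: if_splits)
    have "\<sigma> * snd p \<le> \<sigma> * snd x" if "x \<in> table W"
      using that \<sigma> elim(2,3) ij(1) unfolding table_geometry_iff by (fastforce simp: abs_if split: if_splits)
    moreover have "outgoing_velocity W x u = u - (2 * (u \<bullet> (0, \<sigma>))) *\<^sub>R (0, \<sigma>)" if "x \<in> sides W" for u
      using that v h \<sigma> by (cases u) (auto simp: sides_def outgoing_velocity_def inner_prod_def)
    ultimately show ?case
      using \<sigma> v h on by (auto simp: half_plane_at_def sides_def inner_prod_def)
  qed
  thus ?thesis using \<sigma>
    by (intro exI[of _ "(0, \<sigma>)"] exI[of _ "\<sigma> * snd p"]) (auto simp: norm_prod_def)
qed

lemma half_plane_locally:
  assumes "admissible W" "p \<in> table W" "p \<notin> corners W"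
  obtains n c \<rho> where "norm n = 1" "\<rho> > 0" "\<And>x. dist x p < \<rho> \<Longrightarrow> half_plane_at W n c x"
proof -
  have "\<exists>n c. norm n = 1 \<and> (\<forall>\<^sub>F x in nhds p. half_plane_at W n c x)"
    using assms half_plane_off_sides half_plane_vertical_side half_plane_horizontal_side
    unfolding sides_def by blast
  thus thesis using that unfolding eventually_nhds_metric by blast
qed

section \<open>Configurations that agree near the origin\<close>

definition agree_on_box :: "nat \<Rightarrow> configuration \<Rightarrow> configuration \<Rightarrow> bool" where
  "agree_on_box l W W' \<longleftrightarrow> (\<forall>i j. \<bar>i\<bar> \<le> int l \<longrightarrow> \<bar>j\<bar> \<le> int l \<longrightarrow> W (i, j) = W' (i, j))"

text \<open>The margin 1 covers the half width and half height of an obstacle: a site whose closed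
  rectangle reaches x differs from x by less than 1 in each coordinate, so it lies in the
  box.\<close>

lemma agree_on_box_geometry:
  assumes W: "admissible W" "admissible W'" and l: "agree_on_box l W W'" and x: "norm x + 1 \<le> l"
  shows "x \<in> table W \<longleftrightarrow> x \<in> table W'" "x \<in> vertical_sides W \<longleftrightarrow> x \<in> vertical_sides W'"
    "x \<in> horizontal_sides W \<longleftrightarrow> x \<in> horizontal_sides W'" "x \<in> corners W \<longleftrightarrow> x \<in> corners W'"
proof -
  have "\<bar>fst x\<bar> \<le> norm x" "\<bar>snd x\<bar> \<le> norm x"
    using norm_fst_le[of "fst x" "snd x"] norm_snd_le[of "snd x" "fst x"] by auto
  hence *: "W (i, j) = W' (i, j)" if "\<bar>fst x - of_int i\<bar> < 1" "\<bar>snd x - of_int j\<bar> < 1" for i j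
    using l that x unfolding agree_on_box_def by (intro l[unfolded agree_on_box_def, rule_format]) linarith+
  have close: "\<bar>fst x - of_int i\<bar> < 1" "\<bar>snd x - of_int j\<bar> < 1"
    if "\<bar>fst x - of_int i\<bar> \<le> fst (V (i, j)) / 2" "\<bar>snd x - of_int j\<bar> \<le> snd (V (i, j)) / 2"
      "admissible V" for i j V
    using that(1,2) admissibleD(1,2)[OF that(3), of "(i, j)"] by linarith+
  note 1 = close[OF _ _ W(1)] and 2 = close[OF _ _ W(2)]
  show "x \<in> table W \<longleftrightarrow> x \<in> table W'" unfolding table_geometry_iff
    using * 1 2 by (metis order_less_imp_le)
  show "x \<in> vertical_sides W \<longleftrightarrow> x \<in> vertical_sides W'" unfolding table_geometry_iff
    using * 1 2 by (metis order_less_imp_le order_refl)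
  show "x \<in> horizontal_sides W \<longleftrightarrow> x \<in> horizontal_sides W'" unfolding table_geometry_iff
    using * 1 2 by (metis order_less_imp_le order_refl)
  show "x \<in> corners W \<longleftrightarrow> x \<in> corners W'" unfolding table_geometry_iff
    using * 1 2 by (metis order_refl)
qed

lemma agree_on_box_trajectory:
  assumes W: "admissible W" "admissible W'" and l: "agree_on_box l W W'"
    and traj: "trajectory_on W {-m<..<m} q v" and x: "norm (q 0) + m + 1 \<le> l"
  shows "trajectory_on W' {-m<..<m} q v"
  unfolding trajectory_on_def
proof
  fix t assume t: "t \<in> {-m<..<m}"
  have "norm (q t - q 0) \<le> \<bar>t\<bar>"
  proof (cases "0 \<le> t")
    case True
    moreover have "{0..<m} \<subseteq> {-m<..<m}" using t by auto
    ultimately show ?thesis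
      using trajectory_nonexpanding[OF trajectory_on_mono[OF traj], of 0 m t] t by auto
  next
    \<comment> \<open>\<open>trajectory_nonexpanding\<close> runs forward only, so for negative t it
      is applied from time t up to time 0.\<close>
    case False
    moreover have "{t..<m} \<subseteq> {-m<..<m}" using t by auto
    ultimately show ?thesis using trajectory_nonexpanding[OF trajectory_on_mono[OF traj], of t m 0] t
      by (auto simp: norm_minus_commute)
  qed
  hence "norm (q t) + 1 \<le> l" using norm_triangle_ineq[of "q t - q 0" "q 0"] t x by auto
  moreover have "regular_at W q v t" using t traj by (simp add: trajectory_on_def)
  moreover have "outgoing_velocity W (q t) = outgoing_velocity W' (q t)"
    using agree_on_box_geometry[OF W l, of "q t"] calculation(1)
    by (simp add: outgoing_velocity_def fun_eq_iff)
  ultimately show "regular_at W' q v t"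
    using agree_on_box_geometry[OF W l, of "q t"] unfolding regular_at_def by metis
qed

section \<open>Continuity of the flow\<close>

text \<open>Unfolding of the reflection: \<open>z + (t - a) * k\<close> is the signed height of the
  free motion above the line, and once it is negative the free position is mirrored in the line. At
  height 0 the velocity is already the reflected one, hence the strict inequality in the second
  formula. The bound \<open>near\<close> keeps the path where the half plane describes the
  table.\<close>

lemma reflected_motion:
  assumes traj: "trajectory_on W {a..<b} q v" and n: "norm n = 1"
    and hp: "\<And>x. dist x p < \<rho> \<Longrightarrow> half_plane_at W n c x"
    and z: "0 < z" "z = q a \<bullet> n - c" and near: "dist (q a) p + (b - a) \<le> \<rho>"
    and k: "k = v a \<bullet> n" and t: "a \<le> t" "t < b"
  shows "q t = q a + (t - a) *\<^sub>R v a - (2 * min 0 (z + (t - a) * k)) *\<^sub>R n \<and>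
    v t = (if z + (t - a) * k > 0 then v a else v a - (2 * k) *\<^sub>R n)" (is "?P t")
proof (rule real_induction[where a = a and b = b and t = t and P = ?P])
  show "?P a" using z by simp
next
  fix t assume t: "a \<le> t" "t < b" and P: "\<And>s. a \<le> s \<Longrightarrow> s \<le> t \<Longrightarrow> ?P s"
  from t traj have "regular_at W q v t" by (simp add: trajectory_on_def)
  then obtain \<epsilon> where "\<epsilon> > 0"
    and q: "\<And>h. 0 \<le> h \<Longrightarrow> h < \<epsilon> \<Longrightarrow> q (t + h) = q t + h *\<^sub>R v t \<and> v (t + h) = v t"
    by (elim regular_atE) metis
  define y where "y = z + (t - a) * k"
  have y_add: "z + (t + h - a) * k = y + h * k" for h by (simp add: y_def algebra_simps)
  have Pt: "q t = q a + (t - a) *\<^sub>R v a - (2 * min 0 y) *\<^sub>R n"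
    "v t = (if y > 0 then v a else v a - (2 * k) *\<^sub>R n)" using P[of t] t by (auto simp: y_def)
  show "\<exists>\<epsilon>>0. \<forall>h\<in>{0<..<\<epsilon>}. t + h < b \<longrightarrow> ?P (t + h)"
  proof (cases "y > 0")
    case True
    \<comment> \<open>The height changes at rate k, so it stays positive for this long; adding 1
      avoids division by 0.\<close>
    define \<delta> where "\<delta> = min \<epsilon> (y / (\<bar>k\<bar> + 1))"
    have "y + h * k > 0" if "0 < h" "h < \<delta>" for h
    proof -
      have "h * (\<bar>k\<bar> + 1) < y" using that by (simp add: \<delta>_def field_simps)
      moreover have "- (h * k) \<le> h * \<bar>k\<bar>" using that abs_ge_minus_self[of "h * k"] by (simp add: abs_mult)
      ultimately show ?thesis using that by (simp add: algebra_simps)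
    qed
    hence "?P (t + h)" if "0 < h" "h < \<delta>" for h
      unfolding y_add using that q[of h] Pt True by (simp add: \<delta>_def algebra_simps)
    moreover have "\<delta> > 0" using True \<open>\<epsilon> > 0\<close> by (simp add: \<delta>_def)
    ultimately show ?thesis by auto
  next
    case False
    hence "(t - a) * k < 0" using z by (simp add: y_def)
    hence "k < 0" using t by (simp add: mult_less_0_iff)
    hence "y + h * k \<le> 0" if "0 < h" for h
      using False that mult_pos_neg[of h k] by simp
    hence "\<not> 0 < y + h * k" "min 0 (y + h * k) = y + h * k" if "0 < h" for h
      using that by (fastforce simp: min_def)+
    hence "?P (t + h)" if "0 < h" "h < \<epsilon>" for h
      unfolding y_add using that q[of h] Pt False by (simp add: algebra_simps)
    thus ?thesis using \<open>\<epsilon> > 0\<close> by auto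
  qed
next
  fix t assume t: "a < t" "t < b" and P: "\<And>s. a \<le> s \<Longrightarrow> s < t \<Longrightarrow> ?P s"
  from t traj have "regular_at W q v t" by (simp add: trajectory_on_def)
  then obtain \<epsilon> u where "\<epsilon> > 0" and v: "v t = outgoing_velocity W (q t) u"
    and q: "\<And>h. 0 < h \<Longrightarrow> h < \<epsilon> \<Longrightarrow> q (t - h) = q t - h *\<^sub>R u \<and> v (t - h) = u"
    by (elim regular_atE) metis
  define y where "y = z + (t - a) * k"
  have y_diff: "z + (t - h - a) * k = y - h * k" for h by (simp add: y_def algebra_simps)
  have "dist (q t) (q a) \<le> t - a"
    using trajectory_nonexpanding[OF traj, of t] t by (simp add: dist_norm)
  hence "dist (q t) p < \<rho>" using near t dist_triangle[of "q t" p "q a"] by simp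
  note hp_t = hp[OF this, unfolded half_plane_at_def]
  have off: "v t = u" if "q t \<bullet> n \<noteq> c" using hp_t v that outgoing_velocity_off_sides by auto
  have on: "v t = u - (2 * (u \<bullet> n)) *\<^sub>R n" if "q t \<bullet> n = c" using hp_t v that by metis
  have nn: "n \<bullet> n = 1" using n by (simp add: dot_square_norm)
  show "?P t"
  proof (cases "y \<ge> 0")
    case True
    define h where "h = min (\<epsilon> / 2) (t - a)"
    have h: "0 < h" "h < \<epsilon>" "h \<le> t - a" using \<open>\<epsilon> > 0\<close> t by (auto simp: h_def)
    have "y - h * k > 0"
    proof (cases "k \<ge> 0")
      case True
      have "h * k \<le> (t - a) * k" using h True by (intro mult_right_mono) auto
      thus ?thesis using z by (simp add: y_def)
    next
      case False
      thus ?thesis using \<open>y \<ge> 0\<close> h mult_pos_neg[of h k] by simp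
    qed
    hence "q (t - h) = q a + (t - h - a) *\<^sub>R v a" "v (t - h) = v a"
      using P[of "t - h"] h unfolding y_diff by auto
    hence u: "u = v a" and qt: "q t = q a + (t - a) *\<^sub>R v a"
      using q[of h] h by (auto simp: algebra_simps)
    have "q t \<bullet> n - c = y" using z k by (simp add: qt y_def inner_add_left)
    thus ?thesis using True off on qt u k unfolding y_def[symmetric] by auto
  next
    case False
    hence "(t - a) * k < 0" using z by (simp add: y_def)
    hence "k < 0" using t by (simp add: mult_less_0_iff)
    \<comment> \<open>Here \<open>y / k\<close> is the time elapsed since the collision. Stepping
      back by at most this much stays on the reflected piece, which includes the collision time
      itself.\<close>
    define h where "h = min (min (\<epsilon> / 2) (t - a)) (y / k)"
    have h: "0 < h" "h < \<epsilon>" "h \<le> t - a" using \<open>\<epsilon> > 0\<close> t False \<open>k < 0\<close>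
      by (auto simp: h_def divide_neg_neg)
    have "h \<le> y / k" by (simp add: h_def)
    hence "y - h * k \<le> 0" using \<open>k < 0\<close> by (simp add: field_simps)
    hence Ph: "q (t - h) = q a + (t - h - a) *\<^sub>R v a - (2 * (y - h * k)) *\<^sub>R n"
       "v (t - h) = v a - (2 * k) *\<^sub>R n"
      using P[of "t - h"] h unfolding y_diff by auto
    hence u: "u = v a - (2 * k) *\<^sub>R n" using q[of h] h by simp
    have "q t = q (t - h) + h *\<^sub>R u" using q[of h] h by simp
    hence qt: "q t = q a + (t - a) *\<^sub>R v a - (2 * y) *\<^sub>R n"
      unfolding Ph u by (simp add: algebra_simps)
    have "q t \<bullet> n - c = - y" using z k nn by (simp add: qt y_def inner_add_left inner_diff_left)
    thus ?thesis using False off qt u unfolding y_def[symmetric] by auto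
  qed
qed (use t in auto)

text \<open>The formulas of \<open>reflected_motion\<close> are evaluated along the filter. The
  position formula is continuous, the mirror term being a minimum; the velocity formula jumps only
  at height 0, that is, when r is a collision time.\<close>

lemma flow_continuous_locally:
  fixes Q V :: "'i \<Rightarrow> real \<Rightarrow> vec"
  assumes traj: "trajectory_on W {a..<b} q v"
    and near_traj: "\<forall>\<^sub>F i in F. trajectory_on W {a..<b} (Q i) (V i)"
    and n: "norm n = 1" and hp: "\<And>x. dist x p < \<rho> \<Longrightarrow> half_plane_at W n c x"
    and near: "dist (q a) p + (b - a) < \<rho>"
    and off: "q a \<notin> sides W" "q r \<notin> sides W" and r: "a \<le> r" "r < b"
    and lim: "((\<lambda>i. Q i a) \<longlongrightarrow> q a) F" "((\<lambda>i. V i a) \<longlongrightarrow> v a) F"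
  shows "((\<lambda>i. Q i r) \<longlongrightarrow> q r) F" "((\<lambda>i. V i r) \<longlongrightarrow> v r) F"
proof -
  have ab: "a < b" using r by simp
  define X where "X x w = x + (r - a) *\<^sub>R w - (2 * min 0 (x \<bullet> n - c + (r - a) * (w \<bullet> n))) *\<^sub>R n" for x w :: vec
  define U where "U x w = (if x \<bullet> n - c + (r - a) * (w \<bullet> n) > 0 then w else w - (2 * (w \<bullet> n)) *\<^sub>R n)" for x w :: vec
  have "half_plane_at W n c (q a)" using near ab by (intro hp) simp
  moreover have "q a \<in> table W" using traj ab by (auto simp: trajectory_on_def regular_at_def)
  ultimately have z: "0 < q a \<bullet> n - c" using off(1) by (auto simp: half_plane_at_def order_less_le)
  have formula: "q' r = X (q' a) (v' a) \<and> v' r = U (q' a) (v' a)"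
    if "trajectory_on W {a..<b} q' v'" "0 < q' a \<bullet> n - c" "dist (q' a) p + (b - a) < \<rho>" for q' v'
    using reflected_motion[OF that(1) n hp that(2) refl _ refl r] that(3)
    unfolding X_def U_def by simp
  have qr: "q r = X (q a) (v a)" "v r = U (q a) (v a)" using formula[OF traj z near] by auto
  have lim_n: "((\<lambda>i. Q i a \<bullet> n - c) \<longlongrightarrow> q a \<bullet> n - c) F"
    "((\<lambda>i. dist (Q i a) p + (b - a)) \<longlongrightarrow> dist (q a) p + (b - a)) F"
    by (intro tendsto_intros lim)+
  have ev: "\<forall>\<^sub>F i in F. Q i r = X (Q i a) (V i a) \<and> V i r = U (Q i a) (V i a)"
    \<comment> \<open>Positive initial height and the distance bound are strict for the limit
      trajectory and so hold eventually for the approximating ones.\<close>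
    using near_traj order_tendstoD(1)[OF lim_n(1) z] order_tendstoD(2)[OF lim_n(2) near]
    by eventually_elim (rule formula)
  have "((\<lambda>i. X (Q i a) (V i a)) \<longlongrightarrow> X (q a) (v a)) F"
    unfolding X_def by (intro tendsto_add tendsto_diff tendsto_scaleR tendsto_mult tendsto_min
        tendsto_inner tendsto_const lim)
  moreover have "\<forall>\<^sub>F i in F. X (Q i a) (V i a) = Q i r" using ev by eventually_elim simp
  ultimately show "((\<lambda>i. Q i r) \<longlongrightarrow> q r) F" unfolding qr by (rule Lim_transform_eventually)
  define y where "y = q a \<bullet> n - c + (r - a) * (v a \<bullet> n)"
  have lim_y: "((\<lambda>i. Q i a \<bullet> n - c + (r - a) * (V i a \<bullet> n)) \<longlongrightarrow> y) F"
    unfolding y_def by (intro tendsto_intros lim)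
  have "y \<noteq> 0"
  proof
    assume "y = 0"
    hence "q r \<bullet> n = c" unfolding qr X_def y_def by (simp add: inner_add_left inner_diff_left)
    moreover have "dist (q r) p < \<rho>"
      using trajectory_nonexpanding[OF traj r] near dist_triangle[of "q r" p "q a"] r by (simp add: dist_norm)
    ultimately show False using hp[of "q r"] off(2) by (auto simp: half_plane_at_def)
  qed
  have "((\<lambda>i. U (Q i a) (V i a)) \<longlongrightarrow> U (q a) (v a)) F"
  proof (cases "y > 0")
    case True
    have "\<forall>\<^sub>F i in F. U (Q i a) (V i a) = V i a"
      using order_tendstoD(1)[OF lim_y True] by eventually_elim (simp add: U_def)
    moreover have "U (q a) (v a) = v a" using True by (simp add: U_def y_def)
    ultimately show ?thesis using lim(2) by (simp add: tendsto_cong)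
  next
    case False
    hence "y < 0" using \<open>y \<noteq> 0\<close> by simp
    have "\<forall>\<^sub>F i in F. U (Q i a) (V i a) = V i a - (2 * (V i a \<bullet> n)) *\<^sub>R n"
      using order_tendstoD(2)[OF lim_y \<open>y < 0\<close>] by eventually_elim (simp add: U_def)
    moreover have "U (q a) (v a) = v a - (2 * (v a \<bullet> n)) *\<^sub>R n" using False by (simp add: U_def y_def)
    moreover have "((\<lambda>i. V i a - (2 * (V i a \<bullet> n)) *\<^sub>R n) \<longlongrightarrow> v a - (2 * (v a \<bullet> n)) *\<^sub>R n) F"
      by (intro tendsto_intros lim)
    ultimately show ?thesis by (simp add: tendsto_cong)
  qed
  moreover have "\<forall>\<^sub>F i in F. U (Q i a) (V i a) = V i r" using ev by eventually_elim simp
  ultimately show "((\<lambda>i. V i r) \<longlongrightarrow> v r) F" unfolding qr by (rule Lim_transform_eventually)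
qed

text \<open>On a side, a zero normal component of the incoming velocity would place the path on that
  side just before t, contrary to \<open>left\<close>; reflection negates this component, so the
  path leaves the line. Off the line, unit speed gives a positive time before the line can be
  reached.\<close>

lemma off_sides_after:
  assumes reg: "regular_at W q v t" and n: "norm n = 1" and "\<rho> > 0"
    and hp: "\<And>x. dist x (q t) < \<rho> \<Longrightarrow> half_plane_at W n c x"
    and left: "q t \<in> sides W \<longrightarrow> (\<exists>\<epsilon>>0. \<forall>h\<in>{0<..<\<epsilon>}. q (t - h) \<notin> sides W)"
  shows "\<exists>\<epsilon>>0. \<forall>h\<in>{0<..<\<epsilon>}. q (t + h) \<notin> sides W"
proof -
  from reg obtain \<epsilon> u where "\<epsilon> > 0" and v: "v t = outgoing_velocity W (q t) u"
    and norms: "norm (v t) = 1" "norm u = 1"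
    and q: "\<And>h. 0 \<le> h \<Longrightarrow> h < \<epsilon> \<Longrightarrow> q (t + h) = q t + h *\<^sub>R v t \<and> v (t + h) = v t"
      "\<And>h. 0 < h \<Longrightarrow> h < \<epsilon> \<Longrightarrow> q (t - h) = q t - h *\<^sub>R u \<and> v (t - h) = u"
    by (elim regular_atE) metis
  have nn: "n \<bullet> n = 1" using n by (simp add: dot_square_norm)
  have side: "q (t + h) \<in> sides W \<longleftrightarrow> q t \<bullet> n + h * (v t \<bullet> n) = c" if "0 < h" "h < min \<epsilon> \<rho>" for h
    using hp[of "q (t + h)"] q(1)[of h] that norms
    by (simp add: half_plane_at_def dist_norm inner_add_left)
  have side': "q (t - h) \<in> sides W \<longleftrightarrow> q t \<bullet> n - h * (u \<bullet> n) = c" if "0 < h" "h < min \<epsilon> \<rho>" for h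
    using hp[of "q (t - h)"] q(2)[of h] that norms
    by (simp add: half_plane_at_def dist_norm inner_diff_left)
  have hp_t: "half_plane_at W n c (q t)" using \<open>\<rho> > 0\<close> by (intro hp) simp
  show ?thesis
  proof (cases "q t \<bullet> n = c")
    case True
    then obtain \<delta> where \<delta>: "\<delta> > 0" "\<And>h. 0 < h \<Longrightarrow> h < \<delta> \<Longrightarrow> q (t - h) \<notin> sides W"
      using left hp_t by (auto simp: half_plane_at_def)
    define h where "h = min \<delta> (min \<epsilon> \<rho>) / 2"
    have h: "0 < h" "h < \<delta>" "h < min \<epsilon> \<rho>" using \<delta> \<open>\<epsilon> > 0\<close> \<open>\<rho> > 0\<close> by (auto simp: h_def)
    have "u \<bullet> n \<noteq> 0" using side'[OF h(1,3)] \<delta>(2)[OF h(1,2)] True by auto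
    moreover have "v t = u - (2 * (u \<bullet> n)) *\<^sub>R n" using True hp_t v unfolding half_plane_at_def by metis
    hence "v t \<bullet> n = - (u \<bullet> n)" using nn by (simp add: inner_diff_left)
    ultimately show ?thesis using side True \<open>\<epsilon> > 0\<close> \<open>\<rho> > 0\<close> by (intro exI[of _ "min \<epsilon> \<rho>"]) auto
  next
    case False
    define y where "y = \<bar>q t \<bullet> n - c\<bar>"
    have "y > 0" using False by (simp add: y_def)
    have "\<bar>v t \<bullet> n\<bar> \<le> 1" using Cauchy_Schwarz_ineq2[of "v t" n] norms n by simp
    have "q t \<bullet> n + h * (v t \<bullet> n) \<noteq> c" if "0 < h" "h < y" for h
    proof
      assume "q t \<bullet> n + h * (v t \<bullet> n) = c"
      hence "y = h * \<bar>v t \<bullet> n\<bar>" using that by (auto simp: y_def abs_mult abs_minus_commute)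
      also have "\<dots> \<le> h * 1" using that \<open>\<bar>v t \<bullet> n\<bar> \<le> 1\<close> by (intro mult_left_mono) auto
      finally show False using that by simp
    qed
    thus ?thesis using side \<open>y > 0\<close> \<open>\<epsilon> > 0\<close> \<open>\<rho> > 0\<close> by (intro exI[of _ "min y (min \<epsilon> \<rho>)"]) auto
  qed
qed

text \<open>The alternative rules out trajectories sliding along a side, which cannot arise from
  a position off the sides.\<close>

lemma flow_continuous:
  fixes Q V :: "'i \<Rightarrow> real \<Rightarrow> vec"
  assumes W: "admissible W" and traj: "trajectory_on W {0..<b} q v"
    and near_traj: "\<forall>\<^sub>F i in F. trajectory_on W {0..<b} (Q i) (V i)"
    and off: "q 0 \<notin> sides W"
    and lim: "((\<lambda>i. Q i 0) \<longlongrightarrow> q 0) F" "((\<lambda>i. V i 0) \<longlongrightarrow> v 0) F"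
    and t: "0 \<le> t" "t < b"
  shows "q t \<notin> sides W \<and> ((\<lambda>i. Q i t) \<longlongrightarrow> q t) F \<and> ((\<lambda>i. V i t) \<longlongrightarrow> v t) F \<or>
     q t \<in> sides W \<and> (\<exists>\<epsilon>>0. \<forall>h\<in>{0<..<\<epsilon>}. q (t - h) \<notin> sides W)" (is "?P t")
proof (rule real_induction[where a = 0 and b = b and t = t and P = ?P])
  fix t assume t: "0 \<le> t" "t < b" and P: "\<And>s. 0 \<le> s \<Longrightarrow> s \<le> t \<Longrightarrow> ?P s"
  have reg: "regular_at W q v t" using traj t by (simp add: trajectory_on_def)
  hence "q t \<in> table W" "q t \<notin> corners W" by (simp_all add: regular_at_def)
  then obtain n c \<rho> where n: "norm n = 1" and "\<rho> > 0"
      and hp: "\<And>x. dist x (q t) < \<rho> \<Longrightarrow> half_plane_at W n c x"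
    using half_plane_locally[OF W] by metis
  have "q t \<in> sides W \<longrightarrow> (\<exists>\<epsilon>>0. \<forall>h\<in>{0<..<\<epsilon>}. q (t - h) \<notin> sides W)"
    using P[of t] t by blast
  then obtain \<epsilon> where \<epsilon>: "\<epsilon> > 0" "\<And>h. 0 < h \<Longrightarrow> h < \<epsilon> \<Longrightarrow> q (t + h) \<notin> sides W"
    using off_sides_after[OF reg n \<open>\<rho> > 0\<close> hp] by auto
  \<comment> \<open>At a collision time the induction hypothesis provides no convergence, so the
    local statement is started from an earlier time s off the sides. With the end time at most
    \<open>t + \<rho> / 4\<close>, distance plus duration stays below
    \<open>3 * \<rho> / 4\<close>.\<close>
  have "\<exists>s. 0 \<le> s \<and> s \<le> t \<and> t - s < \<rho> / 4 \<and> q s \<notin> sides W"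
  proof (cases "q t \<in> sides W")
    case True
    then obtain \<delta> where \<delta>: "\<delta> > 0" "\<And>h. 0 < h \<Longrightarrow> h < \<delta> \<Longrightarrow> q (t - h) \<notin> sides W"
      using P[of t] t by auto
    have "t > 0" using True off t by (cases "t = 0") auto
    thus ?thesis using \<delta> \<open>\<rho> > 0\<close>
      by (intro exI[of _ "t - min (\<delta> / 2) (min t (\<rho> / 8))"]) auto
  qed (use t \<open>\<rho> > 0\<close> in auto)
  then obtain s where s: "0 \<le> s" "s \<le> t" "t - s < \<rho> / 4" "q s \<notin> sides W" by auto
  have lim_s: "((\<lambda>i. Q i s) \<longlongrightarrow> q s) F" "((\<lambda>i. V i s) \<longlongrightarrow> v s) F" using P[of s] s by auto
  define b' where "b' = min b (t + \<rho> / 4)"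
  have sub: "{s..<b'} \<subseteq> {0..<b}" using s by (auto simp: b'_def)
  have "dist (q s) (q t) \<le> t - s"
    using trajectory_nonexpanding[OF trajectory_on_mono[OF traj], of s b t] s t
    by (auto simp: dist_norm norm_minus_commute)
  moreover have "b' \<le> t + \<rho> / 4" by (simp add: b'_def)
  ultimately have near: "dist (q s) (q t) + (b' - s) < \<rho>" using s \<open>\<rho> > 0\<close> by linarith
  have traj': "trajectory_on W {s..<b'} q v" by (rule trajectory_on_mono[OF traj sub])
  have near': "\<forall>\<^sub>F i in F. trajectory_on W {s..<b'} (Q i) (V i)"
    using near_traj by eventually_elim (rule trajectory_on_mono[OF _ sub])
  have "?P (t + h)" if h: "0 < h" "h < min \<epsilon> (\<rho> / 4)" "t + h < b" for h
  proof -
    have "s \<le> t + h" "t + h < b'" "q (t + h) \<notin> sides W" using h s \<epsilon> by (auto simp: b'_def)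
    thus ?thesis using flow_continuous_locally[OF traj' near' n hp near s(4) _ _ _ lim_s, of "t + h"]
      by blast
  qed
  thus "\<exists>\<epsilon>>0. \<forall>h\<in>{0<..<\<epsilon>}. t + h < b \<longrightarrow> ?P (t + h)"
    using \<epsilon>(1) \<open>\<rho> > 0\<close> by (intro exI[of _ "min \<epsilon> (\<rho> / 4)"]) auto
next
  fix t assume t: "0 < t" "t < b" and P: "\<And>s. 0 \<le> s \<Longrightarrow> s < t \<Longrightarrow> ?P s"
  have reg: "regular_at W q v t" using traj t by (simp add: trajectory_on_def)
  hence "q t \<in> table W" "q t \<notin> corners W" by (simp_all add: regular_at_def)
  then obtain n c \<rho> where n: "norm n = 1" and "\<rho> > 0"
      and hp: "\<And>x. dist x (q t) < \<rho> \<Longrightarrow> half_plane_at W n c x"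
    using half_plane_locally[OF W] by metis
  from reg obtain \<epsilon> u where "\<epsilon> > 0" and u: "norm u = 1"
    and q: "\<And>h. 0 < h \<Longrightarrow> h < \<epsilon> \<Longrightarrow> q (t - h) = q t - h *\<^sub>R u \<and> v (t - h) = u"
    by (elim regular_atE) metis
  define e where "e = min (min \<epsilon> (\<rho> / 4)) t"
  have e: "e > 0" "e \<le> \<epsilon>" "e \<le> \<rho> / 4" "e \<le> t" using \<open>\<epsilon> > 0\<close> \<open>\<rho> > 0\<close> t by (auto simp: e_def)
  have side: "q (t - h) \<in> sides W \<longleftrightarrow> q t \<bullet> n - h * (u \<bullet> n) = c" if "0 < h" "h < e" for h
    using hp[of "q (t - h)"] q[of h] that u e \<open>\<rho> > 0\<close>
    by (simp add: half_plane_at_def dist_norm inner_diff_left)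
  have hp_t: "q t \<in> sides W \<longleftrightarrow> q t \<bullet> n = c"
    using \<open>\<rho> > 0\<close> hp[of "q t"] by (simp add: half_plane_at_def)
  \<comment> \<open>If the path slid along a side during all of (t - e, t), the induction hypothesis
    at the midpoint \<open>t - e / 2\<close> would fail: neither is that position off the sides, nor
    are the positions just before it.\<close>
  have ex_off: "\<exists>h. 0 < h \<and> h < e \<and> q (t - h) \<notin> sides W"
  proof (rule ccontr)
    assume "\<not> ?thesis"
    hence slide: "q (t - h) \<in> sides W" if "0 < h" "h < e" for h using that by blast
    obtain \<delta> where \<delta>: "\<delta> > 0" "\<And>h. 0 < h \<Longrightarrow> h < \<delta> \<Longrightarrow> q (t - e / 2 - h) \<notin> sides W"
      using P[of "t - e / 2"] slide[of "e / 2"] e by fastforce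
    define h where "h = min \<delta> (e / 2) / 2"
    have "0 < h" "h < \<delta>" "e / 2 + h < e" using \<delta> e by (auto simp: h_def)
    thus False using \<delta>(2)[of h] slide[of "e / 2 + h"] e by (simp add: algebra_simps)
  qed
  show "?P t"
  proof (cases "q t \<in> sides W")
    case True
    \<comment> \<open>The height above the line is linear in h and vanishes at h = 0; being nonzero
      for one h, it is nonzero for all positive h below e.\<close>
    hence "u \<bullet> n \<noteq> 0" using ex_off side hp_t by auto
    thus ?thesis using True side hp_t e(1) by (auto intro!: exI[of _ e])
  next
    case False
    obtain h where h: "0 < h" "h < e" "q (t - h) \<notin> sides W" using ex_off by blast
    hence lim_h: "((\<lambda>i. Q i (t - h)) \<longlongrightarrow> q (t - h)) F" "((\<lambda>i. V i (t - h)) \<longlongrightarrow> v (t - h)) F"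
      using P[of "t - h"] e by auto
    define b' where "b' = min b (t + \<rho> / 4)"
    have sub: "{t - h..<b'} \<subseteq> {0..<b}" using h e by (auto simp: b'_def)
    have traj': "trajectory_on W {t - h..<b'} q v" by (rule trajectory_on_mono[OF traj sub])
    have near': "\<forall>\<^sub>F i in F. trajectory_on W {t - h..<b'} (Q i) (V i)"
      using near_traj by eventually_elim (rule trajectory_on_mono[OF _ sub])
    have "dist (q (t - h)) (q t) \<le> h" using q[of h] h e u by (simp add: dist_norm)
    moreover have "b' \<le> t + \<rho> / 4" by (simp add: b'_def)
    ultimately have near: "dist (q (t - h)) (q t) + (b' - (t - h)) < \<rho>"
      using h e \<open>\<rho> > 0\<close> by linarith
    have "t - h \<le> t" "t < b'" using h t \<open>\<rho> > 0\<close> by (auto simp: b'_def)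
    thus ?thesis using flow_continuous_locally[OF traj' near' n hp near h(3) False _ _ lim_h] False
      by blast
  qed
qed (use off lim t in auto)

section \<open>Returns within bounded time\<close>

definition return_by :: "configuration \<Rightarrow> nat \<Rightarrow> nat \<Rightarrow> vec \<times> vec \<Rightarrow> bool" where
  "return_by W n m x \<longleftrightarrow> (\<exists>q v T. trajectory_on W {-real m<..<real m} q v \<and> (q 0, v 0) = x \<and>
     real n < T \<and> T < real m \<and> dist (q T, v T) x < 1 / real (n + 1))"

text \<open>The flow may be discontinuous at the return time T if T is a collision time. Delaying
  the return to T + h with small h leaves the sides, and the strict inequalities in
  \<open>return_by\<close> leave room for the delay; continuity at T + h then carries the return
  over to nearby points.\<close>

lemma return_by_open:
  assumes W: "admissible W"
  obtains G where "open G"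
    "\<And>x. has_trajectory W m x \<Longrightarrow> fst x \<notin> sides W \<Longrightarrow> x \<in> G \<longleftrightarrow> return_by W n m x"
proof -
  define S where "S = {x. has_trajectory W m x}"
  have "\<exists>G. open G \<and> x \<in> G \<and> (\<forall>y\<in>G. y \<in> S \<longrightarrow> return_by W n m y)"
    if ret: "return_by W n m x" and x: "fst x \<notin> sides W" for x
  proof -
    from ret obtain q v T where traj: "trajectory_on W {-real m<..<real m} q v" and qv: "(q 0, v 0) = x"
      and T: "real n < T" "T < real m" "dist (q T, v T) x < 1 / real (n + 1)"
      unfolding return_by_def by blast
    have "\<forall>y. \<exists>Q V. y \<in> S \<longrightarrow> trajectory_on W {-real m<..<real m} Q V \<and> (Q 0, V 0) = y"
      by (auto simp: S_def has_trajectory_def)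
    then obtain Q where "\<forall>y. \<exists>V. y \<in> S \<longrightarrow>
        trajectory_on W {-real m<..<real m} (Q y) V \<and> (Q y 0, V 0) = y"
      by (rule choice[THEN exE])
    then obtain V where "\<forall>y. y \<in> S \<longrightarrow>
        trajectory_on W {-real m<..<real m} (Q y) (V y) \<and> (Q y 0, V y 0) = y"
      by (rule choice[THEN exE])
    hence QV: "\<And>y. y \<in> S \<Longrightarrow> trajectory_on W {-real m<..<real m} (Q y) (V y)"
       "\<And>y. y \<in> S \<Longrightarrow> Q y 0 = fst y" "\<And>y. y \<in> S \<Longrightarrow> V y 0 = snd y" by (auto simp: prod_eq_iff)
    \<comment> \<open>Only points that have a trajectory are approached, since \<open>S\<close> need
      not be open. The filter omits x itself, where the return is given by
      \<open>ret\<close>.\<close>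
    let ?F = "at x within S"
    have S: "\<forall>\<^sub>F y in ?F. y \<in> S" by (simp add: eventually_at_filter)
    have sub: "{0..<real m} \<subseteq> {-real m<..<real m}" using T by auto
    have traj0: "trajectory_on W {0..<real m} q v" by (rule trajectory_on_mono[OF traj sub])
    have near: "\<forall>\<^sub>F y in ?F. trajectory_on W {0..<real m} (Q y) (V y)"
      using S by eventually_elim (rule trajectory_on_mono[OF QV(1) sub])
    have off: "q 0 \<notin> sides W" using x qv by auto
    have lim: "((\<lambda>y. Q y 0) \<longlongrightarrow> q 0) ?F" "((\<lambda>y. V y 0) \<longlongrightarrow> v 0) ?F"
    proof -
      have "(fst \<longlongrightarrow> fst x) ?F" "(snd \<longlongrightarrow> snd x) ?F" by (auto intro!: tendsto_fst tendsto_snd tendsto_ident_at)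
      moreover have "\<forall>\<^sub>F y in ?F. Q y 0 = fst y" "\<forall>\<^sub>F y in ?F. V y 0 = snd y"
        using S QV by (auto elim: eventually_mono)
      ultimately show "((\<lambda>y. Q y 0) \<longlongrightarrow> q 0) ?F" "((\<lambda>y. V y 0) \<longlongrightarrow> v 0) ?F"
        using qv by (auto simp: tendsto_cong)
    qed
    note cont = flow_continuous[OF W traj0 near off lim]
    have reg: "regular_at W q v T" using traj T by (simp add: trajectory_on_def)
    have "q T \<in> table W" "q T \<notin> corners W" using reg by (simp_all add: regular_at_def)
    then obtain k c \<rho> where hp: "norm k = 1" "\<rho> > 0" "\<And>y. dist y (q T) < \<rho> \<Longrightarrow> half_plane_at W k c y"
      using half_plane_locally[OF W] by metis
    have "0 \<le> T" using T(1) by simp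
    hence "q T \<in> sides W \<longrightarrow> (\<exists>\<epsilon>>0. \<forall>h\<in>{0<..<\<epsilon>}. q (T - h) \<notin> sides W)"
      using cont[of T] T(2) by blast
    then obtain \<epsilon> where \<epsilon>: "\<epsilon> > 0" "\<And>h. 0 < h \<Longrightarrow> h < \<epsilon> \<Longrightarrow> q (T + h) \<notin> sides W"
      using off_sides_after[OF reg hp] by auto
    obtain \<delta> where \<delta>: "\<delta> > 0" "norm (v T) = 1"
      "\<And>h. 0 \<le> h \<Longrightarrow> h < \<delta> \<Longrightarrow> q (T + h) = q T + h *\<^sub>R v T \<and> v (T + h) = v T"
      using reg by (elim regular_atE) metis
    define \<eta> where "\<eta> = 1 / real (n + 1) - dist (q T, v T) x"
    have "\<eta> > 0" using T(3) by (simp add: \<eta>_def)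
    \<comment> \<open>Below \<mu> the delay keeps the path off the sides, on its straight piece,
      before time m, and within the slack \<eta> of the distance bound: at constant velocity the
      phase point moves by exactly h.\<close>
    define \<mu> where "\<mu> = min (min \<epsilon> \<delta>) (min (real m - T) \<eta>)"
    have \<mu>: "0 < \<mu>" "\<mu> \<le> \<epsilon>" "\<mu> \<le> \<delta>" "\<mu> \<le> real m - T" "\<mu> \<le> \<eta>"
      using \<epsilon>(1) \<delta>(1) T(2) \<open>\<eta> > 0\<close> by (auto simp: \<mu>_def)
    define h where "h = \<mu> / 2"
    have h: "0 < h" "h < \<epsilon>" "h < \<delta>" "T + h < real m" "h < \<eta>"
      using \<mu> unfolding h_def by linarith+
    define T' where "T' = T + h"
    have T': "real n < T'" "T' < real m" "0 \<le> T'" "q T' \<notin> sides W" using T h \<epsilon> by (auto simp: T'_def)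
    have "dist (q T') (q T) = h" "v T' = v T" unfolding T'_def
      using \<delta>(2) \<delta>(3)[of h] h by (simp_all add: dist_norm)
    hence "dist (q T', v T') (q T, v T) \<le> h" using h by (simp add: dist_Pair_Pair)
    hence d: "dist (q T', v T') x < 1 / real (n + 1)"
      using h dist_triangle[of "(q T', v T')" x "(q T, v T)"] by (simp add: \<eta>_def)
    have "((\<lambda>y. Q y T') \<longlongrightarrow> q T') ?F" "((\<lambda>y. V y T') \<longlongrightarrow> v T') ?F" using cont[OF T'(3,2)] T'(4) by auto
    hence "((\<lambda>y. dist (Q y T', V y T') y) \<longlongrightarrow> dist (q T', v T') x) ?F"
      by (intro tendsto_intros)
    from order_tendstoD(2)[OF this d] S have "\<forall>\<^sub>F y in ?F. return_by W n m y"
    proof eventually_elim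
      case (elim y)
      thus ?case unfolding return_by_def using QV[of y] T'
        by (intro exI[of _ "Q y"] exI[of _ "V y"] exI[of _ T']) auto
    qed
    then obtain G where "open G" "x \<in> G" "\<forall>y\<in>G. y \<noteq> x \<longrightarrow> y \<in> S \<longrightarrow> return_by W n m y"
      unfolding eventually_at_topological by blast
    thus ?thesis using ret by metis
  qed
  then obtain G where G: "\<And>x. return_by W n m x \<Longrightarrow> fst x \<notin> sides W \<Longrightarrow>
      open (G x) \<and> x \<in> G x \<and> (\<forall>y\<in>G x. y \<in> S \<longrightarrow> return_by W n m y)" by metis
  show thesis
  proof (rule that)
    show "open (\<Union>x\<in>{x. return_by W n m x \<and> fst x \<notin> sides W}. G x)" using G by auto
    show "x \<in> (\<Union>x\<in>{x. return_by W n m x \<and> fst x \<notin> sides W}. G x) \<longleftrightarrow> return_by W n m x"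
      if "has_trajectory W m x" "fst x \<notin> sides W" for x
      using G that unfolding S_def by blast
  qed
qed

section \<open>Phase volume\<close>

text \<open>Using the whole plane gives one measure for all configurations. The table becomes a
  premise inside the statements, which makes conditions on different configurations
  comparable.\<close>

definition phase_measure :: "(vec \<times> vec) measure" where
  "phase_measure = lborel \<Otimes>\<^sub>M circle_measure"

lemma sets_circle_measure [measurable_cong, simp]: "sets circle_measure = sets borel"
  by (simp add: circle_measure_def)

lemma space_circle_measure [simp]: "space circle_measure = UNIV"
  by (simp add: circle_measure_def)

lemma finite_circle_measure: "finite_measure circle_measure"
proof -
  have "(\<lambda>\<theta>. (cos \<theta>, sin \<theta>)) \<in> restrict_space lborel {0..<2 * pi} \<rightarrow>\<^sub>M (borel :: vec measure)"
    by (rule measurable_restrict_space1) measurable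
  hence "emeasure circle_measure UNIV = emeasure (restrict_space lborel {0..<2 * pi}) {0..<2 * pi}"
    unfolding circle_measure_def by (subst emeasure_distr) (auto simp: space_restrict_space)
  also have "\<dots> = ennreal (2 * pi)" by (subst emeasure_restrict_space) auto
  finally show ?thesis by (intro finite_measureI) simp
qed

interpretation circle_measure: finite_measure circle_measure
  by (rule finite_circle_measure)

lemma sets_phase_measure [measurable_cong, simp]: "sets phase_measure = sets borel"
proof -
  have "sets phase_measure = sets ((borel :: vec measure) \<Otimes>\<^sub>M (borel :: vec measure))"
    unfolding phase_measure_def by (intro sets_pair_measure_cong) auto
  thus ?thesis by (simp only: borel_prod)
qed

lemma space_phase_measure [simp]: "space phase_measure = UNIV"
  by (simp add: phase_measure_def space_pair_measure)

lemma emeasure_phase_measure_cball: "emeasure phase_measure (cball 0 r \<times> UNIV) < \<infinity>"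
  unfolding phase_measure_def
  using emeasure_lborel_cball_finite[of "0 :: vec" r]
    circle_measure.emeasure_finite[of UNIV, unfolded infinity_ennreal_def less_top]
  by (subst circle_measure.emeasure_pair_measure_Times) (simp_all add: ennreal_mult_less_top)

lemma AE_phase_measure_fst:
  assumes "AE p in lborel. P p"
  shows "AE x in phase_measure. P (fst x)"
proof -
  from assms obtain N where N: "N \<in> null_sets lborel" "{p. \<not> P p} \<subseteq> N"
    unfolding eventually_ae_filter by auto
  have "N \<times> UNIV \<in> null_sets phase_measure"
    unfolding phase_measure_def using N by (intro circle_measure.times_in_null_sets1) auto
  thus ?thesis using N by (intro AE_I'[of "N \<times> UNIV"]) auto
qed

lemma AE_off_sides: "AE x in phase_measure. fst x \<notin> sides W"
proof -
  \<comment> \<open>The sides are covered by full vertical and horizontal lines with countably many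
    abscissae and ordinates.\<close>
  define C where "C = (\<Union>(i, j) \<in> UNIV. {of_int i + fst (W (i, j)) / 2, of_int i - fst (W (i, j)) / 2})"
  define D where "D = (\<Union>(i, j) \<in> UNIV. {of_int j + snd (W (i, j)) / 2, of_int j - snd (W (i, j)) / 2})"
  have "countable C" "countable D" unfolding C_def D_def by (auto intro!: countable_UN)
  hence "C \<in> null_sets lborel" "D \<in> null_sets lborel" by (auto intro: countable_imp_null_set_lborel)
  hence "C \<times> UNIV \<in> null_sets (lborel \<Otimes>\<^sub>M lborel)" "UNIV \<times> D \<in> null_sets (lborel \<Otimes>\<^sub>M lborel)"
    by (auto intro: lborel.times_in_null_sets1 lborel.times_in_null_sets2)
  hence "C \<times> UNIV \<union> UNIV \<times> D \<in> null_sets lborel" unfolding lborel_prod by (rule null_sets.Un)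
  moreover have "sides W \<subseteq> C \<times> UNIV \<union> UNIV \<times> D"
  proof
    fix x assume "x \<in> sides W"
    then obtain i j where "\<bar>fst x - of_int i\<bar> = fst (W (i, j)) / 2 \<or> \<bar>snd x - of_int j\<bar> = snd (W (i, j)) / 2"
      unfolding sides_def Un_iff table_geometry_iff by blast
    hence "fst x \<in> {of_int i + fst (W (i, j)) / 2, of_int i - fst (W (i, j)) / 2} \<or>
        snd x \<in> {of_int j + snd (W (i, j)) / 2, of_int j - snd (W (i, j)) / 2}"
      by (auto simp: abs_if split: if_splits)
    hence "fst x \<in> C \<or> snd x \<in> D" unfolding C_def D_def by blast
    thus "x \<in> C \<times> UNIV \<union> UNIV \<times> D" by (cases x) auto
  qed
  ultimately have "AE p in lborel. p \<notin> sides W" by (auto intro: AE_I')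
  thus ?thesis by (rule AE_phase_measure_fst)
qed

lemma table_borel [measurable]: "table W \<in> sets borel"
proof -
  let ?R = "\<lambda>i j. {p :: vec. \<bar>fst p - of_int i\<bar> < fst (W (i, j)) / 2 \<and> \<bar>snd p - of_int j\<bar> < snd (W (i, j)) / 2}"
  have eq: "table W = - (\<Union>ij \<in> obstacle_sites W. ?R (fst ij) (snd ij))"
    by (simp add: set_eq_iff table_iff obstacle_sites_def split_paired_All)
  have "open (?R i j)" for i j
    by (intro open_Collect_conj open_Collect_less continuous_intros)
  thus ?thesis unfolding eq by (intro borel_comp borel_open open_UN ballI)
qed

text \<open>By uniqueness of the product of sigma-finite measures it suffices to compare rectangles.
  For the sigma-algebras, one inclusion comes from rectangles and the other from measurability of
  the inclusion map \<open>id\<close>.\<close>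

lemma phase_volume_eq: "phase_volume W = restrict_space phase_measure (table W \<times> UNIV)"
proof -
  let ?T = "table W" and ?L = "lborel :: vec measure"
  have T: "?T \<times> UNIV \<in> sets phase_measure"
    unfolding phase_measure_def by (intro pair_measureI) auto
  have id: "(\<lambda>x. x) \<in> phase_volume W \<rightarrow>\<^sub>M phase_measure"
  proof -
    have "(\<lambda>x. (fst x, snd x)) \<in> restrict_space lborel ?T \<Otimes>\<^sub>M circle_measure \<rightarrow>\<^sub>M lborel \<Otimes>\<^sub>M circle_measure"
      by (intro measurable_Pair measurable_compose[OF measurable_fst measurable_restrict_space1] measurable_snd) simp
    thus ?thesis by (simp add: phase_volume_def phase_measure_def)
  qed
  have space: "space (phase_volume W) = ?T \<times> UNIV"
    by (auto simp: phase_volume_def space_pair_measure space_restrict_space)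
  show ?thesis unfolding phase_volume_def
  proof (rule pair_measure_eqI)
    show "sigma_finite_measure (restrict_space ?L ?T)"
      by (intro sigma_finite_measure_restrict_space lborel.sigma_finite_measure_axioms) simp
    show "sigma_finite_measure circle_measure" by (rule circle_measure.sigma_finite_measure)
    show "sets (restrict_space ?L ?T \<Otimes>\<^sub>M circle_measure) = sets (restrict_space phase_measure (?T \<times> UNIV))"
    proof
      have "a \<times> b \<in> sets (restrict_space phase_measure (?T \<times> UNIV))"
        if "a \<in> sets (restrict_space ?L ?T)" "b \<in> sets circle_measure" for a b
      proof -
        have "a \<in> sets ?L" "a \<subseteq> ?T" using that(1) by (auto simp: sets_restrict_space_iff)
        hence "a \<times> b \<in> sets phase_measure"
          unfolding phase_measure_def using that(2) by (intro pair_measureI)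
        thus ?thesis using T \<open>a \<subseteq> ?T\<close> by (auto simp: sets_restrict_space_iff)
      qed
      moreover have "space (restrict_space phase_measure (?T \<times> UNIV)) =
          space (restrict_space ?L ?T) \<times> space circle_measure"
        by (auto simp: space_restrict_space)
      ultimately show "sets (restrict_space ?L ?T \<Otimes>\<^sub>M circle_measure) \<subseteq>
          sets (restrict_space phase_measure (?T \<times> UNIV))"
        unfolding sets_pair_measure using sets.top[of "restrict_space phase_measure (?T \<times> UNIV)"]
        by (intro sets.sigma_sets_subset') auto
      show "sets (restrict_space phase_measure (?T \<times> UNIV)) \<subseteq> sets (restrict_space ?L ?T \<Otimes>\<^sub>M circle_measure)"
      proof
        fix A assume "A \<in> sets (restrict_space phase_measure (?T \<times> UNIV))"
        hence "A \<in> sets phase_measure" "A \<subseteq> ?T \<times> UNIV" using T by (auto simp: sets_restrict_space_iff)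
        thus "A \<in> sets (restrict_space ?L ?T \<Otimes>\<^sub>M circle_measure)"
          using measurable_sets[OF id, of A] space by (simp add: phase_volume_def Int_absorb2)
      qed
    qed
    fix A B assume A: "A \<in> sets (restrict_space ?L ?T)" and B: "B \<in> sets circle_measure"
    have A': "A \<in> sets ?L" "A \<subseteq> ?T" using A by (auto simp: sets_restrict_space_iff)
    have "emeasure (restrict_space phase_measure (?T \<times> UNIV)) (A \<times> B) = emeasure phase_measure (A \<times> B)"
      using A' T by (intro emeasure_restrict_space) auto
    also have "\<dots> = emeasure ?L A * emeasure circle_measure B"
      unfolding phase_measure_def using A' B by (intro circle_measure.emeasure_pair_measure_Times)
    also have "emeasure ?L A = emeasure (restrict_space ?L ?T) A"
      using A' by (intro emeasure_restrict_space[symmetric]) auto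
    finally show "emeasure (restrict_space ?L ?T) A * emeasure circle_measure B =
        emeasure (restrict_space phase_measure (?T \<times> UNIV)) (A \<times> B)" by simp
  qed
qed

text \<open>The metric form of \<open>recurrent_point\<close> from
  \<open>recurrent_point_iff\<close>, free of the description operator in the flow.\<close>

definition returning :: "configuration \<Rightarrow> vec \<times> vec \<Rightarrow> bool" where
  "returning W x \<longleftrightarrow> (\<exists>q v. billiard_trajectory W q v \<and> (q 0, v 0) = x \<and>
     (\<forall>n::nat. \<exists>T>real n. dist (q T, v T) x < 1 / real (n + 1)))"

lemma recurrent_wind_tree_iff:
  "recurrent_wind_tree W \<longleftrightarrow> (AE x in phase_measure. fst x \<in> table W \<longrightarrow> returning W x)"
proof -
  have "table W \<times> UNIV \<inter> space phase_measure \<in> sets phase_measure"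
    unfolding phase_measure_def by (intro sets.Int pair_measureI sets.top) auto
  from AE_restrict_space_iff[OF this] show ?thesis
    unfolding recurrent_wind_tree_def recurrent_flow_def recurrent_point_iff phase_volume_eq
      returning_def by (simp add: mem_Times_iff)
qed

section \<open>Shift invariance of recurrence\<close>

text \<open>One implication each is enough: the converse is the same statement for -k applied to
  \<open>shift k W\<close>. As \<open>shift k\<close> reads the index ij + k, it translates the
  table by -d.\<close>

lemma shift_geometry_imp:
  fixes k :: "int \<times> int"
  defines "d \<equiv> (of_int (fst k), of_int (snd k)) :: vec"
  shows "x + d \<in> table W \<Longrightarrow> x \<in> table (shift k W)"
    "x \<in> vertical_sides (shift k W) \<Longrightarrow> x + d \<in> vertical_sides W"
    "x \<in> horizontal_sides (shift k W) \<Longrightarrow> x + d \<in> horizontal_sides W"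
    "x \<in> corners (shift k W) \<Longrightarrow> x + d \<in> corners W"
proof -
  have s: "shift k W (i, j) = W (i + fst k, j + snd k)" for i j by (cases k) (simp add: shift_def)
  have d: "fst (x + d) - of_int (i + fst k) = fst x - of_int i"
    "snd (x + d) - of_int (j + snd k) = snd x - of_int j" for i j
    by (simp_all add: d_def)
  show "x \<in> table (shift k W)" if *: "x + d \<in> table W"
    unfolding table_iff
  proof (intro allI)
    fix i j
    show "shift k W (i, j) \<noteq> (0, 0) \<longrightarrow> \<not> (\<bar>fst x - of_int i\<bar> < fst (shift k W (i, j)) / 2 \<and>
        \<bar>snd x - of_int j\<bar> < snd (shift k W (i, j)) / 2)"
      using *[unfolded table_iff, rule_format, of "i + fst k" "j + snd k"] unfolding s d by blast
  qed
  show "x \<in> vertical_sides (shift k W) \<Longrightarrow> x + d \<in> vertical_sides W"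
    unfolding vertical_sides_iff s using d by metis
  show "x \<in> horizontal_sides (shift k W) \<Longrightarrow> x + d \<in> horizontal_sides W"
    unfolding horizontal_sides_iff s using d by metis
  show "x \<in> corners (shift k W) \<Longrightarrow> x + d \<in> corners W"
    unfolding corners_iff s using d by metis
qed

lemma shift_shift: "shift (- k) (shift k W) = W"
  by (simp add: shift_def)

lemma shift_geometry:
  fixes k :: "int \<times> int"
  defines "d \<equiv> (of_int (fst k), of_int (snd k)) :: vec"
  shows "x \<in> table (shift k W) \<longleftrightarrow> x + d \<in> table W"
    "x \<in> vertical_sides (shift k W) \<longleftrightarrow> x + d \<in> vertical_sides W"
    "x \<in> horizontal_sides (shift k W) \<longleftrightarrow> x + d \<in> horizontal_sides W"
    "x \<in> corners (shift k W) \<longleftrightarrow> x + d \<in> corners W"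
proof -
  have "x + d + (of_int (fst (- k)), of_int (snd (- k))) = x" by (simp add: d_def prod_eq_iff)
  note inv = shift_geometry_imp[of "x + d" "- k" "shift k W", unfolded shift_shift this]
  show "x \<in> table (shift k W) \<longleftrightarrow> x + d \<in> table W"
    "x \<in> vertical_sides (shift k W) \<longleftrightarrow> x + d \<in> vertical_sides W"
    "x \<in> horizontal_sides (shift k W) \<longleftrightarrow> x + d \<in> horizontal_sides W"
    "x \<in> corners (shift k W) \<longleftrightarrow> x + d \<in> corners W"
    using inv shift_geometry_imp[of x k W] unfolding d_def by blast+
qed

lemma regular_at_translate:
  fixes k :: "int \<times> int"
  defines "d \<equiv> (of_int (fst k), of_int (snd k)) :: vec"
  assumes "regular_at W q v t"
  shows "regular_at (shift k W) (\<lambda>s. q s - d) v t"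
proof -
  have g: "q t - d \<in> table (shift k W) \<longleftrightarrow> q t \<in> table W"
    "q t - d \<in> corners (shift k W) \<longleftrightarrow> q t \<in> corners W"
    "outgoing_velocity (shift k W) (q t - d) = outgoing_velocity W (q t)"
    using shift_geometry[of "q t - d" k W] unfolding d_def[symmetric]
    by (simp_all add: outgoing_velocity_def fun_eq_iff)
  have e: "q r - d = q t - d + c \<longleftrightarrow> q r = q t + c" "q r - d = q t - d - c \<longleftrightarrow> q r = q t - c" for r c
    by (auto simp: algebra_simps)
  show ?thesis using assms(2) unfolding regular_at_def g e .
qed

text \<open>Translating positions preserves Lebesgue measure, hence \<open>phase_measure\<close>, so
  an almost-everywhere statement can be pulled back along \<open>?\<tau>\<close>. Translated
  trajectories keep their velocities and the distances between phase points.\<close>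

lemma recurrent_wind_tree_shift_imp:
  assumes "recurrent_wind_tree W"
  shows "recurrent_wind_tree (shift k W)"
proof -
  define d where "d = ((of_int (fst k), of_int (snd k)) :: vec)"
  let ?\<tau> = "\<lambda>(p :: vec, u :: vec). (d + p, u)"
  have "distr lborel borel ((+) d) \<Otimes>\<^sub>M distr circle_measure circle_measure (\<lambda>u. u) =
      distr phase_measure (borel \<Otimes>\<^sub>M circle_measure) ?\<tau>"
    unfolding phase_measure_def
    by (intro pair_measure_distr) (auto simp: distr_id circle_measure.sigma_finite_measure)
  hence \<tau>: "distr phase_measure (borel \<Otimes>\<^sub>M circle_measure) ?\<tau> = phase_measure"
    by (simp add: lborel_distr_plus distr_id phase_measure_def)
  have ret: "returning (shift k W) x" if "returning W (?\<tau> x)" for x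
  proof -
    from that obtain q v where traj: "trajectory_on W UNIV q v" and q0: "(q 0, v 0) = ?\<tau> x"
      and n: "\<And>n::nat. \<exists>T>real n. dist (q T, v T) (?\<tau> x) < 1 / real (n + 1)"
      unfolding returning_def billiard_trajectory_iff by blast
    have "trajectory_on (shift k W) UNIV (\<lambda>s. q s - d) v"
      using traj regular_at_translate unfolding trajectory_on_def d_def by blast
    moreover have "(q 0 - d, v 0) = x" using q0 by (cases x) auto
    moreover have "dist (q T - d, v T) x = dist (q T, v T) (?\<tau> x)" for T
      by (cases x) (auto simp: dist_Pair_Pair dist_norm algebra_simps)
    ultimately show ?thesis unfolding returning_def billiard_trajectory_iff using n by metis
  qed
  have "?\<tau> \<in> phase_measure \<rightarrow>\<^sub>M borel \<Otimes>\<^sub>M circle_measure"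
    unfolding phase_measure_def by measurable
  moreover have "AE x in distr phase_measure (borel \<Otimes>\<^sub>M circle_measure) ?\<tau>. fst x \<in> table W \<longrightarrow> returning W x"
    using assms unfolding \<tau> recurrent_wind_tree_iff .
  ultimately have "AE x in phase_measure. fst (?\<tau> x) \<in> table W \<longrightarrow> returning W (?\<tau> x)"
    by (rule AE_distrD)
  thus ?thesis unfolding recurrent_wind_tree_iff
  proof eventually_elim
    case (elim x)
    thus ?case using ret[of x] shift_geometry(1)[of "fst x" k W]
      by (cases x) (auto simp: d_def add.commute)
  qed
qed

lemma recurrent_wind_tree_shift: "recurrent_wind_tree (shift k W) \<longleftrightarrow> recurrent_wind_tree W"
  using recurrent_wind_tree_shift_imp[of W k] recurrent_wind_tree_shift_imp[of "shift k W" "- k"]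
  by (auto simp: shift_shift)

section \<open>Recurrence as a countable combination of local conditions\<close>

text \<open>A longer window asks for a longer trajectory, which is the reason for the last premise;
  by uniqueness it passes through the same phase point at time T.\<close>

lemma return_by_mono:
  assumes "return_by W n m x" "m \<le> m'" "has_trajectory W m' x"
  shows "return_by W n m' x"
proof -
  from assms(1) obtain q v T where traj: "trajectory_on W {-real m<..<real m} q v" and qv: "(q 0, v 0) = x"
    and T: "real n < T" "T < real m" "dist (q T, v T) x < 1 / real (n + 1)"
    unfolding return_by_def by blast
  from assms(3) obtain q' v' where traj': "trajectory_on W {-real m'<..<real m'} q' v'" "(q' 0, v' 0) = x"
    unfolding has_trajectory_def by blast
  have "trajectory_on W {-real m<..<real m} q' v'"
    using assms(2) by (intro trajectory_on_mono[OF traj'(1)]) auto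
  hence "q T = q' T \<and> v T = v' T"
    using trajectory_unique[OF traj, of q' v' T] qv traj'(2) T by auto
  thus ?thesis unfolding return_by_def using traj' T assms(2)
    by (intro exI[of _ q'] exI[of _ v'] exI[of _ T]) auto
qed

lemma returning_iff:
  "returning W x \<longleftrightarrow> (\<forall>m. has_trajectory W (real m) x) \<and> (\<forall>n. \<exists>m. return_by W n m x)"
proof
  assume "returning W x"
  then obtain q v where qv: "trajectory_on W UNIV q v" "(q 0, v 0) = x"
    and rec: "\<And>n::nat. \<exists>T>real n. dist (q T, v T) x < 1 / real (n + 1)"
    unfolding returning_def billiard_trajectory_iff by blast
  have sub: "trajectory_on W {-real m<..<real m} q v" for m
    by (rule trajectory_on_mono[OF qv(1)]) simp
  have "\<exists>m. return_by W n m x" for n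
  proof -
    obtain T where T: "T > real n" "dist (q T, v T) x < 1 / real (n + 1)" using rec by blast
    obtain m :: nat where "T < real m" using reals_Archimedean2 by blast
    thus ?thesis unfolding return_by_def using sub[of m] qv(2) T by blast
  qed
  thus "(\<forall>m. has_trajectory W (real m) x) \<and> (\<forall>n. \<exists>m. return_by W n m x)"
    using sub qv(2) unfolding has_trajectory_def by blast
next
  assume R: "(\<forall>m. has_trajectory W (real m) x) \<and> (\<forall>n. \<exists>m. return_by W n m x)"
  then obtain q v where qv: "trajectory_on W UNIV q v" "(q 0, v 0) = x"
    using regular_points_iff[of x W] unfolding regular_points_def billiard_trajectory_iff by blast
  have "\<exists>T>real n. dist (q T, v T) x < 1 / real (n + 1)" for n
  proof -
    obtain m q' v' T where *: "trajectory_on W {-real m<..<real m} q' v'" "(q' 0, v' 0) = x"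
      "real n < T" "T < real m" "dist (q' T, v' T) x < 1 / real (n + 1)"
      using R unfolding return_by_def by blast
    have "trajectory_on W {-real m<..<real m} q v" by (rule trajectory_on_mono[OF qv(1)]) simp
    hence "q' T = q T \<and> v' T = v T"
      using trajectory_unique[OF *(1), of q v T] qv(2) * by auto
    thus ?thesis using * by auto
  qed
  thus "returning W x" unfolding returning_def billiard_trajectory_iff using qv by blast
qed

text \<open>The bounds on position and duration make this depend on finitely many obstacles. Over
  all m and k it expresses that almost every point of the table is regular, which
  \<open>recurrent_wind_tree\<close> includes.\<close>

definition almost_all_have_trajectory :: "nat \<Rightarrow> nat \<Rightarrow> configuration \<Rightarrow> bool" where
  "almost_all_have_trajectory m k W \<longleftrightarrow>
     (AE x in phase_measure. norm (fst x) \<le> k \<and> fst x \<in> table W \<longrightarrow> has_trajectory W m x)"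

text \<open>The covering set \<open>A\<close> makes this an outer measure estimate, so that no measurability of
  \<open>return_by\<close> is presupposed.\<close>

definition most_return_by :: "nat \<Rightarrow> nat \<Rightarrow> nat \<Rightarrow> nat \<Rightarrow> configuration \<Rightarrow> bool" where
  "most_return_by n k e m W \<longleftrightarrow>
     (\<exists>A\<in>sets phase_measure. emeasure phase_measure A < ennreal (1 / real (Suc e)) \<and>
       (AE x in phase_measure.
          norm (fst x) \<le> k \<and> fst x \<in> table W \<and> \<not> return_by W n m x \<longrightarrow> x \<in> A))"

text \<open>Recurrence makes the points of the bounded part \<open>K\<close> that never return a
  null set, and continuity of the measure from above yields a finite m. The open sets
  \<open>G\<close> supply Borel substitutes for the return sets, correct off the sides wherever a
  trajectory exists.\<close>

lemma most_return_by_if_recurrent: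
  assumes W: "admissible W" and rec: "recurrent_wind_tree W"
  shows "\<exists>m. most_return_by n k e m W"
proof -
  have "\<exists>G. open G \<and> (\<forall>x. has_trajectory W (real m) x \<longrightarrow> fst x \<notin> sides W \<longrightarrow> (x \<in> G \<longleftrightarrow> return_by W n m x))" for m
    using return_by_open[OF W, of m n] by metis
  then obtain G where G: "\<And>m. open (G m)"
      "\<And>m x. has_trajectory W (real m) x \<Longrightarrow> fst x \<notin> sides W \<Longrightarrow> x \<in> G m \<longleftrightarrow> return_by W n m x"
    by metis
  define K where "K = (cball 0 (real k) \<inter> table W) \<times> (UNIV :: vec set)"
  \<comment> \<open>The sets \<open>G m\<close> need not be monotone at points without a trajectory;
    subtracting all of them up to m forces \<open>A\<close> to decrease. \<open>K\<close> has finite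
    volume because positions in it are bounded.\<close>
  define A where "A m = K - (\<Union>l\<le>m. G l)" for m
  have K: "K \<in> sets phase_measure"
    unfolding K_def phase_measure_def by (intro pair_measureI) auto
  have A: "A m \<in> sets phase_measure" for m
    unfolding A_def using G(1) by (intro sets.Diff K) auto
  have ret: "AE x in phase_measure. fst x \<in> table W \<longrightarrow> returning W x"
    using rec by (simp add: recurrent_wind_tree_iff)
  have "AE x in phase_measure. x \<notin> (\<Inter>m. A m)"
    using ret AE_off_sides[of W]
  proof eventually_elim
    case (elim x)
    show ?case
    proof
      assume "x \<in> (\<Inter>m. A m)"
      hence x: "x \<in> K" "\<And>l m. l \<le> m \<Longrightarrow> x \<notin> G l" unfolding A_def by blast+
      hence "returning W x" using elim(1) by (simp add: K_def mem_Times_iff)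
      then obtain m where "return_by W n m x" "has_trajectory W (real m) x"
        unfolding returning_iff by blast
      thus False using G(2) elim(2) x(2)[of m m] by auto
    qed
  qed
  hence "(\<Inter>m. A m) \<in> null_sets phase_measure"
    using A by (subst AE_iff_null_sets) auto
  moreover have "(\<lambda>m. emeasure phase_measure (A m)) \<longlonglongrightarrow> emeasure phase_measure (\<Inter>m. A m)"
  proof (rule Lim_emeasure_decseq)
    show "range A \<subseteq> sets phase_measure" using A by auto
    show "decseq A" unfolding A_def decseq_def by fastforce
    have cb: "cball 0 (real k) \<times> (UNIV :: vec set) \<in> sets phase_measure"
      unfolding phase_measure_def by (intro pair_measureI) auto
    have "emeasure phase_measure (A m) \<le> emeasure phase_measure (cball 0 (real k) \<times> UNIV)" for m
      using cb by (intro emeasure_mono) (auto simp: A_def K_def)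
    thus "emeasure phase_measure (A m) \<noteq> \<infinity>" for m
      using emeasure_phase_measure_cball[of "real k"] by (metis less_le_not_le order_le_less_trans)
  qed
  ultimately have "(\<lambda>m. emeasure phase_measure (A m)) \<longlonglongrightarrow> 0" by (simp add: null_setsD1)
  hence "\<forall>\<^sub>F m in sequentially. emeasure phase_measure (A m) < ennreal (1 / real (Suc e))"
    by (rule order_tendstoD) simp
  then obtain m where m: "emeasure phase_measure (A m) < ennreal (1 / real (Suc e))"
    unfolding eventually_sequentially by blast
  have "AE x in phase_measure. norm (fst x) \<le> k \<and> fst x \<in> table W \<and> \<not> return_by W n m x \<longrightarrow> x \<in> A m"
    using ret AE_off_sides[of W]
  proof eventually_elim
    case (elim x)
    show ?case
    proof
      assume x: "norm (fst x) \<le> k \<and> fst x \<in> table W \<and> \<not> return_by W n m x"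
      hence traj: "has_trajectory W (real l) x" for l using elim by (simp add: returning_iff)
      have "x \<notin> G l" if "l \<le> m" for l
        using return_by_mono[OF _ that traj] G(2)[OF traj elim(2)] x by blast
      thus "x \<in> A m" using x by (auto simp: A_def K_def mem_Times_iff)
    qed
  qed
  thus ?thesis unfolding most_return_by_def using A m by blast
qed

text \<open>For the converse, fix n and k. A point that fails to return within every window lies, up
  to null sets, in all the covering sets \<open>A e\<close>, even though the window
  \<open>M e\<close> varies with e; their intersection has measure 0.\<close>

lemma recurrent_wind_tree_iff_local:
  assumes W: "admissible W"
  shows "recurrent_wind_tree W \<longleftrightarrow>
    (\<forall>m k. almost_all_have_trajectory m k W) \<and> (\<forall>n k e. \<exists>m. most_return_by n k e m W)"
proof
  assume rec: "recurrent_wind_tree W"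
  have "almost_all_have_trajectory m k W" for m k
    using rec unfolding recurrent_wind_tree_iff almost_all_have_trajectory_def
    by eventually_elim (auto simp: returning_iff)
  thus "(\<forall>m k. almost_all_have_trajectory m k W) \<and> (\<forall>n k e. \<exists>m. most_return_by n k e m W)"
    using most_return_by_if_recurrent[OF W rec] by blast
next
  assume R: "(\<forall>m k. almost_all_have_trajectory m k W) \<and> (\<forall>n k e. \<exists>m. most_return_by n k e m W)"
  have traj: "AE x in phase_measure. \<forall>(m::nat) (k::nat).
      norm (fst x) \<le> k \<and> fst x \<in> table W \<longrightarrow> has_trajectory W m x"
    using R unfolding almost_all_have_trajectory_def AE_all_countable by blast
  have "AE x in phase_measure. norm (fst x) \<le> k \<and> fst x \<in> table W \<longrightarrow> (\<exists>m. return_by W n m x)" for n k :: nat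
  proof -
    let ?Q = "\<lambda>e m A. A \<in> sets phase_measure \<and> emeasure phase_measure A < ennreal (1 / real (Suc e)) \<and>
       (AE x in phase_measure. norm (fst x) \<le> k \<and> fst x \<in> table W \<and> \<not> return_by W n m x \<longrightarrow> x \<in> A)"
    have "\<forall>e. \<exists>m A. ?Q e m A"
      using R unfolding most_return_by_def by blast
    then obtain M where "\<forall>e. \<exists>A. ?Q e (M e) A" by (rule choice[THEN exE])
    then obtain A where "\<forall>e. ?Q e (M e) (A e)" by (rule choice[THEN exE])
    hence A: "\<And>e. A e \<in> sets phase_measure"
      "\<And>e. emeasure phase_measure (A e) < ennreal (1 / real (Suc e))"
      "\<And>e. AE x in phase_measure. norm (fst x) \<le> k \<and> fst x \<in> table W \<and> \<not> return_by W n (M e) x \<longrightarrow> x \<in> A e"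
      by blast+
    have "emeasure phase_measure (\<Inter>e. A e) \<le> 0"
    proof (rule LIMSEQ_le_const)
      show "(\<lambda>e. ennreal (1 / real (Suc e))) \<longlonglongrightarrow> 0"
        using tendsto_ennrealI[OF LIMSEQ_Suc[OF lim_1_over_n]] by simp
      show "\<exists>N. \<forall>e\<ge>N. emeasure phase_measure (\<Inter>e. A e) \<le> ennreal (1 / real (Suc e))"
      proof (intro exI allI impI)
        fix e
        have "emeasure phase_measure (\<Inter>e. A e) \<le> emeasure phase_measure (A e)"
          using A(1) by (intro emeasure_mono) auto
        thus "emeasure phase_measure (\<Inter>e. A e) \<le> ennreal (1 / real (Suc e))" using A(2)[of e] by simp
      qed
    qed
    hence "(\<Inter>e. A e) \<in> null_sets phase_measure" using A(1) by (intro null_setsI) auto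
    hence "AE x in phase_measure. x \<notin> (\<Inter>e. A e)" by (rule AE_not_in)
    moreover have "AE x in phase_measure. \<forall>e. norm (fst x) \<le> k \<and> fst x \<in> table W \<and>
        \<not> return_by W n (M e) x \<longrightarrow> x \<in> A e"
      using A(3) by (simp add: AE_all_countable)
    ultimately show ?thesis by eventually_elim blast
  qed
  hence "AE x in phase_measure. \<forall>n k::nat. norm (fst x) \<le> k \<and> fst x \<in> table W \<longrightarrow> (\<exists>m. return_by W n m x)"
    unfolding AE_all_countable by blast
  with traj show "recurrent_wind_tree W" unfolding recurrent_wind_tree_iff
  proof eventually_elim
    case (elim x)
    obtain k :: nat where "norm (fst x) \<le> k" using real_arch_simple by blast
    thus ?case unfolding returning_iff using elim by blast
  qed
qed

section \<open>Dependence on finitely many obstacles\<close>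

lemma agree_on_box_has_trajectory:
  assumes W: "admissible W" "admissible W'" and l: "agree_on_box l W W'" and x: "norm (fst x) + m + 1 \<le> l"
    and "has_trajectory W m x"
  shows "has_trajectory W' m x"
proof -
  from assms(5) obtain q v where qv: "trajectory_on W {-m<..<m} q v" "(q 0, v 0) = x"
    unfolding has_trajectory_def by blast
  hence "norm (q 0) + m + 1 \<le> l" using x by auto
  from agree_on_box_trajectory[OF W l qv(1) this] show ?thesis
    unfolding has_trajectory_def using qv(2) by blast
qed

lemma agree_on_box_return_by:
  assumes W: "admissible W" "admissible W'" and l: "agree_on_box l W W'" and x: "norm (fst x) + m + 1 \<le> l"
    and "return_by W n m x"
  shows "return_by W' n m x"
proof -
  from assms(5) obtain q v T where qv: "trajectory_on W {-real m<..<real m} q v" "(q 0, v 0) = x"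
    "real n < T" "T < real m" "dist (q T, v T) x < 1 / real (n + 1)"
    unfolding return_by_def by blast
  hence "norm (q 0) + m + 1 \<le> l" using x by auto
  from agree_on_box_trajectory[OF W l qv(1) this] show ?thesis
    unfolding return_by_def using qv by blast
qed

text \<open>The box size adds up the start within k of the origin, a path shorter than m, and the
  margin 1 for the extent of an obstacle.\<close>

lemma agree_on_box_almost_all_have_trajectory:
  assumes W: "admissible W" "admissible W'" and l: "agree_on_box (k + m + 1) W W'"
    and "almost_all_have_trajectory m k W"
  shows "almost_all_have_trajectory m k W'"
  using assms(4) unfolding almost_all_have_trajectory_def
proof eventually_elim
  case (elim x)
  show ?case
  proof
    assume x: "norm (fst x) \<le> k \<and> fst x \<in> table W'"
    hence "fst x \<in> table W" using agree_on_box_geometry(1)[OF W l, of "fst x"] by simp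
    thus "has_trajectory W' m x" using elim x agree_on_box_has_trajectory[OF W l, of x m] by simp
  qed
qed

text \<open>The same covering set \<open>A\<close> works for both configurations, because their
  tables coincide on the bounded region and returns from there within time m see the same
  obstacles.\<close>

lemma agree_on_box_most_return_by:
  assumes W: "admissible W" "admissible W'" and l: "agree_on_box (k + m + 1) W W'"
    and "most_return_by n k e m W"
  shows "most_return_by n k e m W'"
proof -
  from assms(4) obtain A where A: "A \<in> sets phase_measure" "emeasure phase_measure A < ennreal (1 / real (Suc e))"
    "AE x in phase_measure. norm (fst x) \<le> k \<and> fst x \<in> table W \<and> \<not> return_by W n m x \<longrightarrow> x \<in> A"
    unfolding most_return_by_def by blast
  have "AE x in phase_measure. norm (fst x) \<le> k \<and> fst x \<in> table W' \<and> \<not> return_by W' n m x \<longrightarrow> x \<in> A"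
    using A(3)
  proof eventually_elim
    case (elim x)
    show ?case
    proof
      assume x: "norm (fst x) \<le> k \<and> fst x \<in> table W' \<and> \<not> return_by W' n m x"
      hence "fst x \<in> table W" using agree_on_box_geometry(1)[OF W l, of "fst x"] by simp
      thus "x \<in> A" using elim x agree_on_box_return_by[OF W l, of x m n] by auto
    qed
  qed
  thus ?thesis unfolding most_return_by_def using A by blast
qed

section \<open>Measurability and the zero-one law\<close>

text \<open>With each W the set contains the cylinder of all configurations that agree with W on the
  box, so it is open and therefore Borel.\<close>

lemma local_condition_measurable:
  assumes \<nu>: "borel_probability_on (configuration_topology F) \<nu>"
    and loc: "\<And>W W'. W \<in> space \<nu> \<Longrightarrow> W' \<in> space \<nu> \<Longrightarrow> agree_on_box l W W' \<Longrightarrow> P W \<Longrightarrow> P W'"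
  shows "Measurable.pred \<nu> P"
proof -
  let ?X = "configuration_topology F" and ?S = "{W \<in> space \<nu>. P W}"
  have space: "space \<nu> = UNIV \<rightarrow>\<^sub>E F"
    using \<nu> by (simp add: borel_probability_on_def configuration_topology_def)
  have "openin ?X ?S" unfolding configuration_topology_def openin_product_topology_alt
  proof
    fix W assume W: "W \<in> ?S"
    define B where "B = {- int l..int l} \<times> {- int l..int l}"
    \<comment> \<open>Singletons are open since \<open>F\<close> is discrete, and only the finitely
      many sites of \<open>B\<close> are constrained.\<close>
    define U where "U ij = (if ij \<in> B then {W ij} else F)" for ij
    show "\<exists>U. finite {i \<in> UNIV. U i \<noteq> topspace (discrete_topology F)} \<and>
        (\<forall>i\<in>UNIV. openin (discrete_topology F) (U i)) \<and> W \<in> Pi\<^sub>E UNIV U \<and> Pi\<^sub>E UNIV U \<subseteq> ?S"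
    proof (intro exI[of _ U] conjI ballI)
      have "{i \<in> UNIV. U i \<noteq> topspace (discrete_topology F)} \<subseteq> B" by (auto simp: U_def)
      thus "finite {i \<in> UNIV. U i \<noteq> topspace (discrete_topology F)}"
        by (rule finite_subset) (simp add: B_def)
      have WF: "W ij \<in> F" for ij using W PiE_mem[of W UNIV "\<lambda>_. F" ij] by (simp add: space)
      thus "openin (discrete_topology F) (U ij)" "W \<in> Pi\<^sub>E UNIV U" for ij
        by (auto simp: U_def PiE_iff)
      show "Pi\<^sub>E UNIV U \<subseteq> ?S"
      proof
        fix W' assume W': "W' \<in> Pi\<^sub>E UNIV U"
        hence "W' ij \<in> U ij" for ij by (rule PiE_mem) simp
        hence *: "W' ij \<in> F" "ij \<in> B \<Longrightarrow> W' ij = W ij" for ij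
          using WF unfolding U_def by (metis singletonD)+
        hence "W' \<in> space \<nu>" by (simp add: space PiE_iff)
        moreover have "agree_on_box l W W'" unfolding agree_on_box_def by (auto intro!: *(2)[symmetric] simp: B_def)
        ultimately show "W' \<in> ?S" using loc W by blast
      qed
    qed
  qed
  hence "?S \<in> sets \<nu>" using \<nu> by (auto simp: borel_probability_on_def)
  thus ?thesis by (simp add: pred_def)
qed

theorem proposition1:
  fixes E' F :: "(real \<times> real) set"
    and \<nu> :: "(int \<times> int \<Rightarrow> real \<times> real) measure"
  assumes "recurrent_dense_gdelta E'"
    and "F \<subseteq> unit_square \<union> {(0, 0)}"
    and "countable F"
    and "F \<inter> (rational_dimensions \<union> E') \<noteq> {}"
    and "borel_probability_on (configuration_topology F) \<nu>"
    and "shift_invariant \<nu>"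
    and "shift_ergodic \<nu>"
  shows "(AE W in \<nu>. recurrent_wind_tree W) \<or> (AE W in \<nu>. \<not> recurrent_wind_tree W)"
proof -
  interpret prob_space \<nu> using assms(5) by (simp add: borel_probability_on_def)
  have space: "space \<nu> = UNIV \<rightarrow>\<^sub>E F"
    using assms(5) by (simp add: borel_probability_on_def configuration_topology_def)
  have adm: "admissible W" if "W \<in> space \<nu>" for W
    using that assms(2) PiE_mem[of W UNIV "\<lambda>_. F"] unfolding space admissible_def by blast
  have [measurable]: "Measurable.pred \<nu> (almost_all_have_trajectory m k)" for m k
    using agree_on_box_almost_all_have_trajectory adm
    by (intro local_condition_measurable[OF assms(5), of "k + m + 1"]) blast
  have [measurable]: "Measurable.pred \<nu> (most_return_by n k e m)" for n k e m
    using agree_on_box_most_return_by adm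
    by (intro local_condition_measurable[OF assms(5), of "k + m + 1"]) blast
  let ?A = "{W \<in> space \<nu>. recurrent_wind_tree W}"
  \<comment> \<open>All quantifiers range over natural numbers, so measurability of the local
    conditions carries over to their combination.\<close>
  have "{W \<in> space \<nu>. (\<forall>m k. almost_all_have_trajectory m k W) \<and> (\<forall>n k e. \<exists>m. most_return_by n k e m W)} \<in> sets \<nu>"
    by measurable
  also have "{W \<in> space \<nu>. (\<forall>m k. almost_all_have_trajectory m k W) \<and> (\<forall>n k e. \<exists>m. most_return_by n k e m W)} = ?A"
    using adm recurrent_wind_tree_iff_local by blast
  finally have A: "?A \<in> sets \<nu>" .
  \<comment> \<open>\<open>shift_ergodic\<close> speaks of sets whose preimage, cut down to the
    space, is exactly the set itself; so the shift must also map the space into itself.\<close>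
  have "shift k W \<in> space \<nu>" if "W \<in> space \<nu>" for k W
    using that PiE_mem[of W UNIV "\<lambda>_. F"] unfolding space shift_def by (simp add: PiE_UNIV_domain)
  hence "shift k -` ?A \<inter> space \<nu> = ?A" for k
    using recurrent_wind_tree_shift by blast
  hence "prob ?A = 0 \<or> prob ?A = 1" using assms(7)[unfolded shift_ergodic_def, rule_format, OF A] by simp
  thus ?thesis unfolding prob_Collect_eq_0[OF A] prob_Collect_eq_1[OF A] by blast
qed

end
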